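(* The entropic entanglement width $E_{\mathrm{wd}}$ is a type II entanglement monotone.
   Context: A subcubic tree is a tree in which every vertex has degree 1 or 3; its degree-1 vertices are leaves. For an $N$-qubit pure state $|\psi\rangle$ on qubits $V=\{1,\dots,N\}$, consider subcubic trees $T$ whose $N$ leaves are identified with the qubits. Deleting an edge $e$ of $T$ leaves two connected components, inducing a bipartition $(A^e_T,B^e_T)$ of $V$. Let $E_{A,B}(|\psi\rangle)=-\mathrm{Tr}(\rho_A\log_2\rho_A)$ with $\rho_A=\mathrm{Tr}_B|\psi\rangle\langle\psi|$. The entropic entanglement width is $E_{\mathrm{wd}}(|\psi\rangle)=\min_T\max_{e\in T}E_{A^e_T,B^e_T}(|\psi\rangle)$, the minimum over all such subcubic trees. For an $N$-qubit $|\psi\rangle$ and an $n$-qubit $|\phi\rangle$, $n\le N$, write $|\psi\rangle\geq_{\mathrm{LOCC}}|\phi\rangle$ if for some set $A$ of $n$ qubits the transformation $|\psi\rangle\to|\phi\rangle^{A}|0\rangle^{\bar A}$ is achievable exactly and with probability one by LOCC (each qubit a separate party). A type II entanglement monotone is a functional $E$ on all $n$-qubit states, all $n$, with $E(|\psi\rangle)\ge E(|\psi'\rangle)$ whenever $|\psi\rangle\geq_{\mathrm{LOCC}}|\psi'\rangle$. *)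

theory Defs
  imports Complex_Main "Jordan_Normal_Form.Char_Poly"
begin

section \<open>Qubit registers and pure states\<close>

text \<open>Qubits of an N-qubit system are numbered 0,...,N-1. A computational basis
  vector is an assignment of bits to qubits, represented as a function
  nat => bool that is False outside the relevant qubit set.\<close>

type_synonym cfg = "nat \<Rightarrow> bool"

definition cfgs_on :: "nat set \<Rightarrow> cfg set" where
  "cfgs_on S = {x. \<forall>q. x q \<longrightarrow> q \<in> S}"

abbreviation cfgs :: "nat \<Rightarrow> cfg set" where
  "cfgs N \<equiv> cfgs_on {0..<N}"

text \<open>Amplitudes of a vector in the N-qubit Hilbert space (zero outside the basis).\<close>
definition hvec :: "nat \<Rightarrow> (cfg \<Rightarrow> complex) \<Rightarrow> bool" where
  "hvec N v \<longleftrightarrow> (\<forall>x. x \<notin> cfgs N \<longrightarrow> v x = 0)"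

definition vnorm :: "nat \<Rightarrow> (cfg \<Rightarrow> complex) \<Rightarrow> real" where
  "vnorm N v = sqrt (\<Sum>x\<in>cfgs N. (cmod (v x))\<^sup>2)"

text \<open>Normalized pure N-qubit state.\<close>
definition pure_state :: "nat \<Rightarrow> (cfg \<Rightarrow> complex) \<Rightarrow> bool" where
  "pure_state N v \<longleftrightarrow> hvec N v \<and> vnorm N v = 1"

section \<open>Reduced density matrices and entanglement entropy\<close>

text \<open>Enumeration of the basis of the qubits in A by numbers j < 2^card A.\<close>
definition cfg_of :: "nat set \<Rightarrow> nat \<Rightarrow> cfg" where
  "cfg_of A j = (\<lambda>q. \<exists>k<card A. sorted_list_of_set A ! k = q \<and> bit j k)"

definition glue :: "nat set \<Rightarrow> cfg \<Rightarrow> cfg \<Rightarrow> cfg" where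
  "glue A x z = (\<lambda>q. if q \<in> A then x q else z q)"

text \<open>rho_A = Tr_B |psi><psi| for A a subset of the N qubits, B its complement.\<close>
definition reduced_dm :: "nat \<Rightarrow> nat set \<Rightarrow> (cfg \<Rightarrow> complex) \<Rightarrow> complex mat" where
  "reduced_dm N A \<psi> = mat (2 ^ card A) (2 ^ card A)
     (\<lambda>(j, k). \<Sum>z\<in>cfgs_on ({0..<N} - A).
        \<psi> (glue A (cfg_of A j) z) * cnj (\<psi> (glue A (cfg_of A k) z)))"

definition eta :: "real \<Rightarrow> real" where
  "eta t = (if t \<le> 0 then 0 else t * log 2 t)"

text \<open>von Neumann entropy -Tr(rho log2 rho) = - sum over the eigenvalues of rho,
  counted with (algebraic) multiplicity, of lambda log2 lambda (0 log 0 = 0).\<close>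
definition vn_entropy :: "complex mat \<Rightarrow> real" where
  "vn_entropy \<rho> = - (\<Sum>l\<in>{l. eigenvalue \<rho> l}.
       real (order l (char_poly \<rho>)) * eta (Re l))"

definition ent_entropy :: "nat \<Rightarrow> nat set \<Rightarrow> (cfg \<Rightarrow> complex) \<Rightarrow> real" where
  "ent_entropy N A \<psi> = vn_entropy (reduced_dm N A \<psi>)"

section \<open>Subcubic trees\<close>

text \<open>Vertices: Inl q is the leaf identified with qubit q (q < N), Inr k are inner
  vertices. A tree is given by a finite set I of inner vertex labels and a set Et
  of undirected edges (2-element vertex sets).\<close>

type_synonym vtx = "nat + nat"

definition tree_vertices :: "nat \<Rightarrow> nat set \<Rightarrow> vtx set" where
  "tree_vertices N I = Inl ` {0..<N} \<union> Inr ` I"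

definition adj :: "vtx set set \<Rightarrow> (vtx \<times> vtx) set" where
  "adj Et = {(u, v). {u, v} \<in> Et}"

definition degree :: "vtx set set \<Rightarrow> vtx \<Rightarrow> nat" where
  "degree Et v = card {e \<in> Et. v \<in> e}"

definition subcubic_tree :: "nat \<Rightarrow> nat set \<Rightarrow> vtx set set \<Rightarrow> bool" where
  "subcubic_tree N I Et \<longleftrightarrow>
     finite I \<and>
     (\<forall>e\<in>Et. card e = 2 \<and> e \<subseteq> tree_vertices N I) \<and>
     (\<forall>u\<in>tree_vertices N I. \<forall>v\<in>tree_vertices N I. (u, v) \<in> (adj Et)\<^sup>*) \<and>
     card Et + 1 = card (tree_vertices N I) \<and>
     (\<forall>q<N. degree Et (Inl q) = 1) \<and>
     (\<forall>k\<in>I. degree Et (Inr k) = 3)"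

text \<open>The side A of the bipartition induced by deleting edge e: the qubits whose
  leaves lie in the component of (a chosen) endpoint of e.\<close>
definition edge_side :: "nat \<Rightarrow> vtx set set \<Rightarrow> vtx set \<Rightarrow> nat set" where
  "edge_side N Et e = {q. q < N \<and> (SOME u. u \<in> e, Inl q) \<in> (adj (Et - {e}))\<^sup>*}"

section \<open>Entropic entanglement width\<close>

text \<open>Minimum over subcubic trees of the maximal edge entropy. For N < 2 there is
  no subcubic tree with N leaves (or no edge); by convention the width is then 0.\<close>
definition ent_width :: "nat \<Rightarrow> (cfg \<Rightarrow> complex) \<Rightarrow> real" where
  "ent_width N \<psi> =
     (if N < 2 then 0
      else (INF T\<in>{(I, Et). subcubic_tree N I Et}.
              (MAX e\<in>snd T. ent_entropy N (edge_side N (snd T) e) \<psi>)))"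

section \<open>LOCC\<close>

text \<open>A local operator on qubit i: a 2x2 complex matrix K, K b a = <b|K|a>.\<close>
definition apply_local :: "nat \<Rightarrow> (bool \<Rightarrow> bool \<Rightarrow> complex) \<Rightarrow> (cfg \<Rightarrow> complex) \<Rightarrow> (cfg \<Rightarrow> complex)" where
  "apply_local i K \<psi> = (\<lambda>x. \<Sum>b\<in>UNIV. K (x i) b * \<psi> (x(i := b)))"

text \<open>Kraus operators of a (finite-outcome) local instrument: sum_j K_j^dagger K_j = 1.\<close>
definition kraus_complete :: "(bool \<Rightarrow> bool \<Rightarrow> complex) list \<Rightarrow> bool" where
  "kraus_complete Ks \<longleftrightarrow>
     (\<forall>a c. (\<Sum>K\<leftarrow>Ks. \<Sum>b\<in>UNIV. cnj (K b a) * K b c) = (if a = c then 1 else 0))"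

definition normalize_vec :: "nat \<Rightarrow> (cfg \<Rightarrow> complex) \<Rightarrow> (cfg \<Rightarrow> complex)" where
  "normalize_vec N v = (\<lambda>x. complex_of_real (1 / vnorm N v) * v x)"

text \<open>locc_conv N psi phi: psi can be transformed exactly and with probability one
  into phi (up to global phase) by a finite-round LOCC protocol in which every
  qubit is a separate party: in each round one party applies a local instrument
  and broadcasts the outcome; the rest of the protocol may depend on it.\<close>
inductive locc_conv :: "nat \<Rightarrow> (cfg \<Rightarrow> complex) \<Rightarrow> (cfg \<Rightarrow> complex) \<Rightarrow> bool" for N where
  locc_done: "\<lbrakk>cmod c = 1; \<psi> = (\<lambda>x. c * \<phi> x)\<rbrakk> \<Longrightarrow> locc_conv N \<psi> \<phi>"
| locc_step: "\<lbrakk>i < N; kraus_complete Ks;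
          \<forall>K\<in>set Ks. vnorm N (apply_local i K \<psi>) \<noteq> 0 \<longrightarrow>
             locc_conv N (normalize_vec N (apply_local i K \<psi>)) \<phi>\<rbrakk>
        \<Longrightarrow> locc_conv N \<psi> \<phi>"

text \<open>The N-qubit state |phi>^A |0>^(complement of A), where the n qubits of phi
  are placed on A = sigma ` {0..<n} via the injection sigma.\<close>
definition embed_state :: "nat \<Rightarrow> (nat \<Rightarrow> nat) \<Rightarrow> (cfg \<Rightarrow> complex) \<Rightarrow> (cfg \<Rightarrow> complex)" where
  "embed_state n \<sigma> \<phi> = (\<lambda>x. if (\<forall>q. x q \<longrightarrow> q \<in> \<sigma> ` {0..<n})
                             then \<phi> (\<lambda>k. k < n \<and> x (\<sigma> k)) else 0)"

definition locc_geq :: "nat \<Rightarrow> (cfg \<Rightarrow> complex) \<Rightarrow> nat \<Rightarrow> (cfg \<Rightarrow> complex) \<Rightarrow> bool" where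
  "locc_geq N \<psi> n \<phi> \<longleftrightarrow> n \<le> N \<and>
     (\<exists>\<sigma>. inj_on \<sigma> {0..<n} \<and> \<sigma> ` {0..<n} \<subseteq> {0..<N} \<and>
          locc_conv N \<psi> (embed_state n \<sigma> \<phi>))"

definition type2_monotone :: "(nat \<Rightarrow> (cfg \<Rightarrow> complex) \<Rightarrow> real) \<Rightarrow> bool" where
  "type2_monotone E \<longleftrightarrow>
     (\<forall>N n \<psi> \<phi>. pure_state N \<psi> \<longrightarrow> pure_state n \<phi> \<longrightarrow> locc_geq N \<psi> n \<phi> \<longrightarrow>
        E N \<psi> \<ge> E n \<phi>)"

end

theory Submission
  imports Defs
begin

text \<open>Fix a bipartition A, B of the qubits. A local measurement on a qubit of B leaves the
  A-marginal unchanged on average, so by concavity of the von Neumann entropy the entanglement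
  entropy cannot grow on average; since both marginals of a pure state have the same entropy, the
  same holds for measurements on A. Hence a deterministic protocol does not increase the
  entropy of any bipartition. A tree for the N qubits restricts to a tree for the n
  qubits of the target by deleting the other leaves one at a time and suppressing the
  degree-2 vertex this creates; every edge split of the smaller tree is the restriction of an
  edge split of the larger one, and the ancillary |0> qubits do not change entropies.\<close>

section \<open>Spectral theory and von Neumann entropy\<close>

text \<open>Entropy is defined through root multiplicities of the characteristic polynomial, so its
  basic properties are drawn from one algebraic fact: \<open>M * N\<close> and \<open>N * M\<close>
  have the same nonzero roots with multiplicity. This yields unitary invariance, equality of the two
  marginals and insensitivity to padding by zero rows and columns. Concavity needs no operator
  convexity: in an eigenbasis of the mixture, the diagonal entries of the components are averages of
  their eigenvalues with doubly stochastic weights, and scalar Jensen applies. On the tree side the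
  obstacle is that \<open>edge_side\<close> picks an arbitrary endpoint, so a side is meaningful
  only up to complement. Splits are therefore compared through the relation that two leaves stay
  connected, and the symmetry of the entropy absorbs the ambiguity. The infimum runs over a family
  of trees that is infinite in general, since inner labels are arbitrary; it calls for the existence
  of a tree and for a lower bound on the entropies. The bound 0 also settles targets with fewer than
  two qubits, whose width is 0 by convention.\<close>

lemma order_linear_factors:
  fixes x :: "'a::idom"
  shows "order x (\<Prod>a\<leftarrow>as. [:- a, 1:]) = count_list as x"
proof (induction as)
  case (Cons a as)
  have nz: "(\<Prod>a\<leftarrow>as. [:- a, 1:]) \<noteq> 0" by (auto simp: prod_list_zero_iff)
  have lin: "order x [:- a, 1:] = (if a = x then 1 else 0)"
    using order_power_n_n[of a 1] by (auto intro: order_0I)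
  have "order x ([:- a, 1:] * (\<Prod>a\<leftarrow>as. [:- a, 1:]))
      = order x [:- a, 1:] + order x (\<Prod>a\<leftarrow>as. [:- a, 1:])"
    using nz by (intro order_mult) (metis mult_eq_0_iff one_neq_zero pCons_eq_0_iff)
  then show ?case using Cons lin by (simp del: mult_pCons_left)
qed simp

lemma char_poly_nonzero:
  fixes A :: "complex mat"
  assumes "A \<in> carrier_mat n n" shows "char_poly A \<noteq> 0"
  using degree_monic_char_poly[OF assms] by auto

text \<open>\<open>eta 0 = 0\<close> removes the eigenvalue zero from the sum. Only nonzero roots
  count, which makes matrices of different dimensions comparable.\<close>

lemma vn_entropy_nonzero_roots:
  assumes "A \<in> carrier_mat n n"
  shows "vn_entropy A = - (\<Sum>l\<in>{l. l \<noteq> 0 \<and> order l (char_poly A) \<noteq> 0}.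
           real (order l (char_poly A)) * eta (Re l))"
proof -
  have nz: "char_poly A \<noteq> 0" using assms by (rule char_poly_nonzero)
  have ev: "{l. eigenvalue A l} = {l. order l (char_poly A) \<noteq> 0}"
    using eigenvalue_root_char_poly[OF assms] order_root[of "char_poly A"] nz by auto
  have "finite {l. poly (char_poly A) l = 0}" by (rule poly_roots_finite[OF nz])
  then have fin: "finite {l. order l (char_poly A) \<noteq> 0}"
    using order_root[of "char_poly A"] nz by simp
  show ?thesis unfolding vn_entropy_def ev
    by (subst sum.mono_neutral_right[OF fin, of "{l. l \<noteq> 0 \<and> order l (char_poly A) \<noteq> 0}"])
       (auto simp: eta_def)
qed

text \<open>A power of the indeterminate vanishes at most at 0, so it changes no order at a nonzero
  root.\<close>

lemma vn_entropy_eqI: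
  assumes A: "A \<in> carrier_mat n n" and B: "B \<in> carrier_mat m m"
    and eq: "[:0, 1:] ^ k * char_poly A = [:0, 1:] ^ l * char_poly B"
  shows "vn_entropy A = vn_entropy B"
proof -
  have o: "order x (char_poly A) = order x (char_poly B)" if "x \<noteq> 0" for x
  proof -
    have zero: "order x ([:0, 1:] ^ j) = 0" for j
      using that by (intro order_0I) simp
    have "order x ([:0, 1:] ^ k * char_poly A) = order x (char_poly A)"
      using char_poly_nonzero[OF A] zero by (subst order_mult) auto
    moreover have "order x ([:0, 1:] ^ l * char_poly B) = order x (char_poly B)"
      using char_poly_nonzero[OF B] zero by (subst order_mult) auto
    ultimately show ?thesis using eq by simp
  qed
  then have "{x. x \<noteq> 0 \<and> order x (char_poly A) \<noteq> 0} = {x. x \<noteq> 0 \<and> order x (char_poly B) \<noteq> 0}"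
    by auto
  then show ?thesis
    unfolding vn_entropy_nonzero_roots[OF A] vn_entropy_nonzero_roots[OF B]
    using o by (auto intro!: sum.cong)
qed

lemma char_poly_mult_swap:
  fixes M N :: "complex mat"
  assumes M: "M \<in> carrier_mat m k" and N: "N \<in> carrier_mat k m"
  shows "[:0, 1:] ^ k * char_poly (M * N) = [:0, 1:] ^ m * char_poly (N * M)"
proof -
  define X :: "complex poly" where "X = [:0, 1:]"
  define c where "c = map_mat (\<lambda>a :: complex. [:a:])"
  have cM: "c M \<in> carrier_mat m k" and cN: "c N \<in> carrier_mat k m"
    using M N by (auto simp: c_def)
  define P where "P = four_block_mat (X \<cdot>\<^sub>m 1\<^sub>m m) (c M) (c N) (1\<^sub>m k)"
  define L where "L = four_block_mat (1\<^sub>m m) (0\<^sub>m m k) (- c N) (1\<^sub>m k)"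
  define L' where "L' = four_block_mat (1\<^sub>m m) (0\<^sub>m m k) (- c N) (X \<cdot>\<^sub>m 1\<^sub>m k)"
  have Pc: "P \<in> carrier_mat (m + k) (m + k)" and Lc: "L \<in> carrier_mat (m + k) (m + k)"
    and Lc': "L' \<in> carrier_mat (m + k) (m + k)"
    unfolding P_def L_def L'_def using cM cN by auto
  have dL: "det L = 1" unfolding L_def
    using cN by (subst det_four_block_mat_upper_right_zero[of _ m _ k]) auto
  have dL': "det L' = X ^ k" unfolding L'_def
    using cN by (subst det_four_block_mat_upper_right_zero[of _ m _ k]) (auto simp: det_smult)
  have char: "X \<cdot>\<^sub>m 1\<^sub>m (dim_row A) + - c A = char_poly_matrix A"
    if "A \<in> carrier_mat n n" for A n
    using that by (intro eq_matI) (auto simp: char_poly_matrix_def c_def X_def)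
  have cmult: "c (A * B) = c A * c B" if "A \<in> carrier_mat a b" "B \<in> carrier_mat b d" for A B a b d
    unfolding c_def using map_poly_mult(1)[OF that] .
  have MN: "X \<cdot>\<^sub>m 1\<^sub>m m + - (c M * c N) = char_poly_matrix (M * N)"
    using char[OF mult_carrier_mat[OF M N]] M unfolding cmult[OF M N] by simp
  have NM: "- (c N * c M) + X \<cdot>\<^sub>m 1\<^sub>m k = char_poly_matrix (N * M)"
    using char[OF mult_carrier_mat[OF N M]] N cM cN unfolding cmult[OF N M]
    by (simp add: comm_add_mat[of _ k k])
  have PL: "P * L = four_block_mat (char_poly_matrix (M * N)) (c M) (0\<^sub>m k m) (1\<^sub>m k)"
    unfolding P_def L_def
    using cM cN by (subst mult_four_block_mat[of _ m m _ k _ k]) (auto simp: MN intro!: cong_four_block_mat)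
  have LP: "L' * P = four_block_mat (X \<cdot>\<^sub>m 1\<^sub>m m) (c M) (0\<^sub>m k m) (char_poly_matrix (N * M))"
    unfolding P_def L'_def
    using cM cN by (subst mult_four_block_mat[of _ m m _ k _ k])
     (auto simp: NM mult_smult_distrib[of _ k m] mult_smult_assoc_mat[of _ k k] intro!: cong_four_block_mat)
  txt \<open>Both sides are read off one block matrix, made block triangular from the right and from the
    left; the powers of \<open>X\<close> account for the two different dimensions.\<close>
  have "det P = det (P * L)" using det_mult[OF Pc Lc] dL by simp
  also have "\<dots> = char_poly (M * N)" unfolding PL char_poly_def
    using M N cM by (subst det_four_block_mat_lower_left_zero[of _ m _ k]) auto
  finally have 1: "det P = char_poly (M * N)" .
  have "X ^ k * det P = det (L' * P)" using det_mult[OF Lc' Pc] dL' by simp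
  also have "\<dots> = X ^ m * char_poly (N * M)" unfolding LP char_poly_def
    using M N cM by (subst det_four_block_mat_lower_left_zero[of _ m _ k]) (auto simp: det_smult)
  finally show ?thesis unfolding 1 X_def .
qed

text \<open>With an amplitude matrix as factor this exchanges the two marginals; with a unitary or
  an isometry it gives invariance under a change of basis or an embedding.\<close>

lemma vn_entropy_mult_swap:
  assumes "M \<in> carrier_mat m k" "N \<in> carrier_mat k m"
  shows "vn_entropy (M * N) = vn_entropy (N * M)"
  using assms by (intro vn_entropy_eqI[OF _ _ char_poly_mult_swap]) auto

lemma vn_entropy_transpose:
  assumes A: "A \<in> carrier_mat n n"
  shows "vn_entropy (transpose_mat A) = vn_entropy A"
  using A by (intro vn_entropy_eqI[of _ n _ n 0 0]) auto

lemma sum_count_list: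
  fixes f :: "'a \<Rightarrow> real"
  assumes "finite X" "set xs \<subseteq> X"
  shows "(\<Sum>x\<in>X. real (count_list xs x) * f x) = (\<Sum>x\<leftarrow>xs. f x)"
  using assms(2)
proof (induction xs)
  case (Cons a xs)
  have "(\<Sum>x\<in>X. real (count_list (a # xs) x) * f x)
      = (\<Sum>x\<in>X. (if a = x then f x else 0) + real (count_list xs x) * f x)"
    by (intro sum.cong) (auto simp: algebra_simps)
  then show ?case using Cons assms(1) by (simp add: sum.distrib)
qed simp

lemma vn_entropy_upper_triangular:
  assumes A: "A \<in> carrier_mat n n" and ut: "upper_triangular A"
  shows "vn_entropy A = - (\<Sum>k<n. eta (Re (A $$ (k, k))))"
proof -
  let ?as = "diag_mat A"
  have cp: "char_poly A = (\<Prod>a\<leftarrow>?as. [:- a, 1:])"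
    by (rule char_poly_upper_triangular[OF A ut])
  have ev: "{l. eigenvalue A l} = set ?as"
    using eigenvalue_root_char_poly[OF A] unfolding cp
    by (auto simp: poly_prod_list prod_list_zero_iff)
  have "(\<Sum>l\<in>set ?as. real (count_list ?as l) * eta (Re l)) = (\<Sum>a\<leftarrow>?as. eta (Re a))"
    by (rule sum_count_list) auto
  also have "\<dots> = (\<Sum>k<n. eta (Re (A $$ (k, k))))"
    using A by (simp add: diag_mat_def sum_list_distinct_conv_sum_set comp_def atLeast0LessThan)
  finally show ?thesis
    unfolding vn_entropy_def ev cp order_linear_factors by simp
qed

section \<open>Adjoints, unitaries and the Hermitian spectral theorem\<close>

definition dagger :: "complex mat \<Rightarrow> complex mat" where
  "dagger A = transpose_mat (map_mat cnj A)"

lemma dagger_carrier [simp]: "A \<in> carrier_mat m n \<Longrightarrow> dagger A \<in> carrier_mat n m"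
  by (auto simp: dagger_def)

lemma dagger_dim [simp]: "dim_row (dagger A) = dim_col A" "dim_col (dagger A) = dim_row A"
  by (auto simp: dagger_def)

lemma dagger_index [simp]: "i < dim_col A \<Longrightarrow> j < dim_row A \<Longrightarrow> dagger A $$ (i, j) = cnj (A $$ (j, i))"
  by (auto simp: dagger_def)

lemma dagger_dagger [simp]: "dagger (dagger A) = A"
  by (intro eq_matI) auto

lemma dagger_mult:
  assumes "A \<in> carrier_mat l m" "B \<in> carrier_mat m n"
  shows "dagger (A * B) = dagger B * dagger A"
  using assms by (intro eq_matI) (auto simp: scalar_prod_def mult.commute)

lemma dagger_one [simp]: "dagger (1\<^sub>m n) = 1\<^sub>m n"
  by (intro eq_matI) auto

lemma dagger_four_block:
  assumes "A \<in> carrier_mat m n" "B \<in> carrier_mat m n'" "C \<in> carrier_mat m' n" "D \<in> carrier_mat m' n'"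
  shows "dagger (four_block_mat A B C D) = four_block_mat (dagger A) (dagger C) (dagger B) (dagger D)"
  using assms by (intro eq_matI) (auto)

definition unitary_mat :: "nat \<Rightarrow> complex mat \<Rightarrow> bool" where
  "unitary_mat n U \<longleftrightarrow> U \<in> carrier_mat n n \<and> dagger U * U = 1\<^sub>m n \<and> U * dagger U = 1\<^sub>m n"

lemma unitary_mat_mult:
  assumes "unitary_mat n U" "unitary_mat n V"
  shows "unitary_mat n (U * V)"
proof -
  have c: "U \<in> carrier_mat n n" "V \<in> carrier_mat n n" "dagger U \<in> carrier_mat n n" "dagger V \<in> carrier_mat n n"
    using assms by (auto simp: unitary_mat_def)
  have c': "U * V \<in> carrier_mat n n" "dagger V * dagger U \<in> carrier_mat n n" "dagger U * (U * V) \<in> carrier_mat n n"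
    using c by auto
  have u: "dagger U * U = 1\<^sub>m n" "U * dagger U = 1\<^sub>m n" "dagger V * V = 1\<^sub>m n" "V * dagger V = 1\<^sub>m n"
    using assms by (auto simp: unitary_mat_def)
  have "dagger (U * V) * (U * V) = dagger V * ((dagger U * U) * V)"
    unfolding dagger_mult[OF c(1,2)] using c c' by (simp add: assoc_mult_mat[of _ n n _ n _ n])
  also have "\<dots> = 1\<^sub>m n" unfolding u using c u by simp
  finally have 1: "dagger (U * V) * (U * V) = 1\<^sub>m n" .
  have "U * V * dagger (U * V) = U * ((V * dagger V) * dagger U)"
    unfolding dagger_mult[OF c(1,2)] using c c' by (simp add: assoc_mult_mat[of _ n n _ n _ n])
  also have "\<dots> = 1\<^sub>m n" unfolding u using c u by simp
  finally show ?thesis using 1 c by (auto simp: unitary_mat_def)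
qed

lemma unitary_mat_dagger: "unitary_mat n U \<Longrightarrow> unitary_mat n (dagger U)"
  by (auto simp: unitary_mat_def)


text \<open>The reflection 1 - c w w^dagger with w = v - e0 exchanges the unit vector v and the
  first basis vector e0. A Hermitian matrix has a real diagonal and \<open>v $ 0\<close> becomes its
  entry at (0, 0), hence the reality assumption. For v = e0 the vector w vanishes and the identity
  serves instead.\<close>

lemma householder:
  fixes v :: "complex vec"
  assumes v: "v \<in> carrier_vec n" and n: "0 < n"
    and norm: "(\<Sum>i<n. (cmod (v $ i))\<^sup>2) = 1" and real: "v $ 0 \<in> \<real>"
  shows "\<exists>W. W \<in> carrier_mat n n \<and> dagger W = W \<and> W * W = 1\<^sub>m n \<and> (\<forall>i<n. W $$ (i, 0) = v $ i)"
proof (cases "v $ 0 = 1")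
  case True
  have "(\<Sum>i<n. (cmod (v $ i))\<^sup>2) = (cmod (v $ 0))\<^sup>2 + (\<Sum>i\<in>{..<n} - {0}. (cmod (v $ i))\<^sup>2)"
    using n by (intro sum.remove) auto
  then have "(\<Sum>i\<in>{..<n} - {0}. (cmod (v $ i))\<^sup>2) = 0" using norm True by simp
  then have "v $ i = 0" if "i < n" "i \<noteq> 0" for i
    using that by (subst (asm) sum_nonneg_eq_0_iff) auto
  then show ?thesis using True n by (intro exI[of _ "1\<^sub>m n"]) auto
next
  case False
  define w where "w i = v $ i - (if i = 0 then 1 else 0)" for i
  define r where "r = Re (v $ 0)"
  have r: "v $ 0 = complex_of_real r" using real by (simp add: r_def)
  with False have r1: "1 - r \<noteq> 0" by auto
  \<comment> \<open>This is 2 / |w|^2: a unit vector with real first entry \<open>r\<close> has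
    |w|^2 = 2 (1 - r).\<close>
  define c where "c = complex_of_real (1 / (1 - r))"
  have "(\<Sum>i<n. w i * cnj (w i)) = (\<Sum>i<n. complex_of_real ((cmod (v $ i))\<^sup>2) + (if i = 0 then 1 - 2 * v $ 0 else 0))"
    by (intro sum.cong) (auto simp: w_def r complex_norm_square[symmetric] algebra_simps power2_eq_square)
  also have "\<dots> = complex_of_real (\<Sum>i<n. (cmod (v $ i))\<^sup>2) + (1 - 2 * v $ 0)"
    using n by (simp add: sum.distrib)
  finally have ww: "(\<Sum>i<n. w i * cnj (w i)) = 2 * (1 - complex_of_real r)"
    unfolding norm r by simp
  have cww: "c * (\<Sum>i<n. w i * cnj (w i)) = 2"
  proof -
    have "c * (2 * (1 - complex_of_real r)) = complex_of_real (1 / (1 - r) * (2 * (1 - r)))"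
      by (simp add: c_def)
    also have "1 / (1 - r) * (2 * (1 - r)) = 2" using r1 by (simp add: field_simps)
    finally show ?thesis unfolding ww by simp
  qed
  define W where "W = mat n n (\<lambda>(i, j). (if i = j then 1 else 0) - c * (w i * cnj (w j)))"
  have Wc: "W \<in> carrier_mat n n" by (simp add: W_def)
  have "dagger W = W"
    by (intro eq_matI) (auto simp: W_def c_def)
  moreover have "W * W = 1\<^sub>m n"
  proof (intro eq_matI)
    fix i j assume "i < dim_row (1\<^sub>m n)" "j < dim_col (1\<^sub>m n)"
    then have ij: "i < n" "j < n" by auto
    have "(W * W) $$ (i, j) = (\<Sum>k<n. ((if i = k then 1 else 0) - c * (w i * cnj (w k))) *
             ((if k = j then 1 else 0) - c * (w k * cnj (w j))))"
      using ij by (simp add: W_def scalar_prod_def atLeast0LessThan)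
    also have "\<dots> = (\<Sum>k<n. (if k = i then (if i = j then 1 else 0) - c * (w i * cnj (w j)) else 0)
         - (if k = j then c * (w i * cnj (w j)) else 0) + c * c * w i * cnj (w j) * (w k * cnj (w k)))"
      by (intro sum.cong) (auto simp: algebra_simps)
    also have "\<dots> = (if i = j then 1 else 0) - 2 * (c * (w i * cnj (w j)))
         + c * w i * cnj (w j) * (c * (\<Sum>k<n. w k * cnj (w k)))"
      using ij by (simp add: sum.distrib sum_subtractf sum_distrib_left algebra_simps)
    also have "\<dots> = (if i = j then 1 else 0)" unfolding cww by simp
    finally show "(W * W) $$ (i, j) = 1\<^sub>m n $$ (i, j)" using ij by simp
  qed (use Wc in auto)
  moreover have "W $$ (i, 0) = v $ i" if "i < n" for i
  proof -
    have "c * cnj (w 0) = complex_of_real (1 / (1 - r) * (r - 1))"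
      by (simp add: w_def r c_def)
    also have "1 / (1 - r) * (r - 1) = - 1" using r1 by (simp add: field_simps)
    finally have "c * cnj (w 0) = - 1" by simp
    then have "c * (w i * cnj (w 0)) = - w i" by (metis mult.left_commute mult_minus1_right)
    then show ?thesis using that n by (auto simp: W_def w_def)
  qed
  ultimately show ?thesis using Wc by blast
qed

lemma unit_eigenvector:
  fixes A :: "complex mat"
  assumes A: "A \<in> carrier_mat n n" and n: "0 < n"
  shows "\<exists>v e. v \<in> carrier_vec n \<and> A *\<^sub>v v = e \<cdot>\<^sub>v v \<and>
    (\<Sum>i<n. (cmod (v $ i))\<^sup>2) = 1 \<and> v $ 0 \<in> \<real>"
proof -
  obtain as where as: "char_poly A = (\<Prod>a\<leftarrow>as. [:- a, 1:])" "length as = n"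
    using char_poly_factorized[OF A] by blast
  then obtain e where "e \<in> set as" using n by (cases as) auto
  then have "poly (char_poly A) e = 0" by (auto simp: as poly_prod_list prod_list_zero_iff)
  then have "eigenvalue A e" using eigenvalue_root_char_poly[OF A] by simp
  then obtain u where u: "u \<in> carrier_vec n" "u \<noteq> 0\<^sub>v n" "A *\<^sub>v u = e \<cdot>\<^sub>v u"
    using A by (auto simp: eigenvalue_def eigenvector_def)
  define s where "s = sqrt (\<Sum>i<n. (cmod (u $ i))\<^sup>2)"
  have "\<exists>i<n. u $ i \<noteq> 0"
  proof (rule ccontr)
    assume "\<not> (\<exists>i<n. u $ i \<noteq> 0)"
    then have "u = 0\<^sub>v n" using u(1) by (intro eq_vecI) auto
    then show False using u(2) by simp
  qed
  then obtain i where i: "i < n" "u $ i \<noteq> 0" by blast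
  have "(\<Sum>i<n. (cmod (u $ i))\<^sup>2) > 0"
    using i by (intro sum_pos2[of _ i]) auto
  then have s: "s > 0" and s2: "s\<^sup>2 = (\<Sum>i<n. (cmod (u $ i))\<^sup>2)" by (auto simp: s_def)
  \<comment> \<open>An eigenvector is determined only up to a phase; this phase makes the first
    entry real, as the Householder reflection requires.\<close>
  define p where "p = (if u $ 0 = 0 then 1 else cnj (u $ 0) / complex_of_real (cmod (u $ 0)))"
  have p: "cmod p = 1" by (auto simp: p_def norm_divide)
  have pu: "p * u $ 0 = complex_of_real (cmod (u $ 0))"
    by (auto simp: p_def complex_norm_square[symmetric] mult.commute power2_eq_square)
  define t where "t = p / complex_of_real s"
  define v where "v = t \<cdot>\<^sub>v u"
  have "A *\<^sub>v v = e \<cdot>\<^sub>v v"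
    unfolding v_def using u A by (simp add: mult_mat_vec smult_smult_assoc mult.commute)
  moreover have "(\<Sum>i<n. (cmod (v $ i))\<^sup>2) = (\<Sum>i<n. (cmod (u $ i))\<^sup>2) / s\<^sup>2"
    using u(1) s p by (simp add: v_def t_def norm_mult norm_divide sum_divide_distrib power_mult_distrib power_divide)
  then have "(\<Sum>i<n. (cmod (v $ i))\<^sup>2) = 1" unfolding s2[symmetric] using s by simp
  moreover have "v $ 0 \<in> \<real>"
  proof -
    have "v $ 0 = complex_of_real (cmod (u $ 0) / s)"
      using u(1) n pu by (simp add: v_def t_def)
    then show ?thesis by (metis Reals_of_real)
  qed
  moreover have "v \<in> carrier_vec n" using u by (simp add: v_def)
  ultimately show ?thesis by blast
qed

text \<open>Deflation: \<open>W\<close> is a reflection whose first column is a unit eigenvector, so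
  \<open>W * (A * W)\<close> has a multiple of the first basis vector as its first column. Being
  Hermitian it has the matching first row, and it splits into a 1x1 block and a Hermitian block of
  size \<open>n\<close> for the induction.\<close>

lemma hermitian_spectral:
  fixes A :: "complex mat"
  assumes "A \<in> carrier_mat n n" "dagger A = A"
  shows "\<exists>U D. unitary_mat n U \<and> D \<in> carrier_mat n n \<and> diagonal_mat D \<and> A = U * D * dagger U"
  using assms
proof (induction n arbitrary: A)
  case 0
  then have "unitary_mat 0 (1\<^sub>m 0) \<and> A \<in> carrier_mat 0 0 \<and> diagonal_mat A \<and> A = 1\<^sub>m 0 * A * dagger (1\<^sub>m 0)"
    by (auto simp: unitary_mat_def diagonal_mat_def)
  then show ?case by blast
next
  case (Suc n)
  let ?n = "Suc n"
  obtain v e where v: "v \<in> carrier_vec ?n" "A *\<^sub>v v = e \<cdot>\<^sub>v v"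
      "(\<Sum>i<?n. (cmod (v $ i))\<^sup>2) = 1" "v $ 0 \<in> \<real>"
    using unit_eigenvector[OF Suc.prems(1)] by auto
  obtain W where W: "W \<in> carrier_mat ?n ?n" "dagger W = W" "W * W = 1\<^sub>m ?n" "\<forall>i<?n. W $$ (i, 0) = v $ i"
    using householder[OF v(1) _ v(3,4)] by auto
  note A = Suc.prems(1)
  define B where "B = W * (A * W)"
  have B: "B \<in> carrier_mat ?n ?n" using A W by (simp add: B_def)
  have WAW: "W * A \<in> carrier_mat ?n ?n" "A * W \<in> carrier_mat ?n ?n" using A W by auto
  have Bd: "dagger B = B"
    unfolding B_def using W A WAW Suc.prems(2)
    by (simp add: dagger_mult[of _ ?n ?n _ ?n] assoc_mult_mat[of _ ?n ?n _ ?n _ ?n])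
  have colW: "col W 0 = v" using W(1,4) v(1) by (intro eq_vecI) auto
  have Wv: "W *\<^sub>v v = unit_vec ?n 0"
    using col_mult2[OF W(1) W(1), of 0] W(3) by (simp add: colW)
  have "col B 0 = W *\<^sub>v (A *\<^sub>v v)"
    unfolding B_def using col_mult2[OF W(1) WAW(2), of 0] col_mult2[OF A W(1), of 0] by (simp add: colW)
  also have "\<dots> = e \<cdot>\<^sub>v unit_vec ?n 0"
    using mult_mat_vec[OF W(1) v(1)] by (simp add: v(2) Wv)
  finally have colB: "col B 0 = e \<cdot>\<^sub>v unit_vec ?n 0" .
  have B0: "B $$ (i, 0) = (if i = 0 then e else 0)" if "i < ?n" for i
  proof -
    have "B $$ (i, 0) = col B 0 $ i" using that B by simp
    then show ?thesis using that by (simp add: colB)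
  qed
  have B0': "B $$ (0, i) = 0" if "i < ?n" "i \<noteq> 0" for i
  proof -
    have "B $$ (0, i) = dagger B $$ (0, i)" by (simp add: Bd)
    also have "\<dots> = cnj (B $$ (i, 0))" using that B by (intro dagger_index) auto
    finally show ?thesis using that B0 by simp
  qed
  define C where "C = mat n n (\<lambda>(i, j). B $$ (Suc i, Suc j))"
  define E where "E = mat 1 1 (\<lambda>_. e)"
  have C: "C \<in> carrier_mat n n" and E: "E \<in> carrier_mat 1 1" by (auto simp: C_def E_def)
  have Bblock: "B = four_block_mat E (0\<^sub>m 1 n) (0\<^sub>m n 1) C"
    using B by (intro eq_matI) (auto simp: C_def E_def B0 B0')
  have "dagger C = C"
  proof (intro eq_matI)
    fix i j assume "i < dim_row C" "j < dim_col C"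
    then have ij: "Suc i < dim_col B" "Suc j < dim_row B" using B C by auto
    have "B $$ (Suc i, Suc j) = cnj (B $$ (Suc j, Suc i))"
      using dagger_index[OF ij] by (simp add: Bd)
    then show "dagger C $$ (i, j) = C $$ (i, j)" using ij B by (simp add: C_def)
  qed (use C in auto)
  then obtain U D where UD: "unitary_mat n U" "D \<in> carrier_mat n n" "diagonal_mat D" "C = U * D * dagger U"
    using Suc.IH[OF C] by blast
  have U: "U \<in> carrier_mat n n" "dagger U * U = 1\<^sub>m n" "U * dagger U = 1\<^sub>m n"
    using UD(1) by (auto simp: unitary_mat_def)
  define U' where "U' = four_block_mat (1\<^sub>m 1) (0\<^sub>m 1 n) (0\<^sub>m n 1) U"
  define D' where "D' = four_block_mat E (0\<^sub>m 1 n) (0\<^sub>m n 1) D"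
  have z: "dagger (0\<^sub>m a b) = 0\<^sub>m b a" for a b by (intro eq_matI) auto
  have dU': "dagger U' = four_block_mat (1\<^sub>m 1) (0\<^sub>m 1 n) (0\<^sub>m n 1) (dagger U)"
    unfolding U'_def using U(1) by (subst dagger_four_block[of _ 1 1 _ n _ n]) (auto simp: z)
  have one: "four_block_mat (1\<^sub>m 1) (0\<^sub>m 1 n) (0\<^sub>m n 1) (1\<^sub>m n) = (1\<^sub>m ?n :: complex mat)"
    by (intro eq_matI) auto
  have "dagger U' * U' = 1\<^sub>m ?n" "U' * dagger U' = 1\<^sub>m ?n"
    unfolding dU' unfolding U'_def using U
    by (subst mult_four_block_mat[of _ 1 1 _ n _ n _ _ 1 _ n]; simp add: one[simplified])+
  moreover have U'c: "U' \<in> carrier_mat ?n ?n"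
    using four_block_carrier_mat[OF one_carrier_mat[of 1] U(1)] by (simp add: U'_def)
  ultimately have uU': "unitary_mat ?n U'" by (simp add: unitary_mat_def)
  have D'c: "D' \<in> carrier_mat ?n ?n"
    using four_block_carrier_mat[OF E UD(2)] by (simp add: D'_def)
  have "diagonal_mat D'"
    using UD(2,3) E by (auto simp: D'_def diagonal_mat_def)
  have BU: "B = U' * D' * dagger U'"
    unfolding dU' unfolding U'_def D'_def Bblock UD(4) using U UD(2) E
    by (subst mult_four_block_mat[of _ 1 1 _ n _ n _ _ 1 _ n]; simp add: left_add_zero_mat[OF C[unfolded UD(4)]])+
  have uW: "unitary_mat ?n W" using W by (simp add: unitary_mat_def)
  have cc: "dagger U' \<in> carrier_mat ?n ?n" "U' * D' \<in> carrier_mat ?n ?n" "W * U' \<in> carrier_mat ?n ?n" "dagger U' * W \<in> carrier_mat ?n ?n"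
    using U'c D'c W by auto
  have "A = (W * W) * A * (W * W)" unfolding W(3) using A by simp
  also have "\<dots> = W * B * W" unfolding B_def using A W(1) WAW
    by (simp add: assoc_mult_mat[of _ ?n ?n _ ?n _ ?n])
  also have "\<dots> = (W * U') * D' * dagger (W * U')"
    unfolding BU dagger_mult[OF W(1) U'c] W(2) using W(1) U'c D'c cc
    by (simp add: assoc_mult_mat[of _ ?n ?n _ ?n _ ?n])
  finally show ?case using unitary_mat_mult[OF uW uU'] D'c \<open>diagonal_mat D'\<close> by blast
qed

section \<open>Convexity of t log t and concavity of the entropy\<close>

text \<open>The slope is the derivative of t log t at \<open>s\<close>, but the inequality is just
  ln x \<le> x - 1 at x = s / t. At \<open>t = 0\<close> the tangent has the value - s / ln 2, which
  lies below \<open>eta 0 = 0\<close>.\<close>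

lemma eta_tangent:
  assumes s: "0 < s" and t: "0 \<le> t"
  shows "eta s + (log 2 s + 1 / ln 2) * (t - s) \<le> eta t"
proof (cases "t = 0")
  case True
  have "s * (1 / ln 2) \<ge> 0" using s by simp
  then show ?thesis using True s by (simp add: eta_def algebra_simps)
next
  case False
  then have t: "0 < t" using t by simp
  have "ln (s / t) \<le> s / t - 1" using s t by (intro ln_le_minus_one) simp
  then have "t * ln (s / t) \<le> t * (s / t - 1)" using t by (intro mult_left_mono) auto
  then have "t * (ln s - ln t) \<le> s - t" using s t by (simp add: ln_div algebra_simps)
  then have "s * ln s + (ln s + 1) * (t - s) \<le> t * ln t" by (simp add: algebra_simps)
  then have "(s * ln s + (ln s + 1) * (t - s)) / ln 2 \<le> t * ln t / ln 2"
    by (intro divide_right_mono) auto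
  moreover have "(s * ln s + (ln s + 1) * (t - s)) / ln 2 = s * (ln s / ln 2) + (ln s / ln 2 + 1 / ln 2) * (t - s)"
    by (simp add: add_divide_distrib diff_divide_distrib algebra_simps)
  ultimately show ?thesis using s t by (simp add: eta_def log_def)
qed

text \<open>The tangent inequality at the mean is averaged, and the linear terms cancel. At mean 0
  there is no tangent, but then every \<open>t i\<close> of nonzero weight is 0.\<close>

lemma eta_jensen:
  assumes fin: "finite I" and w: "\<And>i. i \<in> I \<Longrightarrow> 0 \<le> w i" "(\<Sum>i\<in>I. w i) = 1"
    and t: "\<And>i. i \<in> I \<Longrightarrow> 0 \<le> t i"
  shows "eta (\<Sum>i\<in>I. w i * t i) \<le> (\<Sum>i\<in>I. w i * eta (t i))"
proof -
  define s where "s = (\<Sum>i\<in>I. w i * t i)"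
  have nn: "0 \<le> w i * t i" if "i \<in> I" for i using that w t by simp
  then have s0: "0 \<le> s" unfolding s_def by (rule sum_nonneg)
  show ?thesis
  proof (cases "s = 0")
    case True
    then have wt: "w i * t i = 0" if "i \<in> I" for i
      using that fin nn unfolding s_def by (subst (asm) sum_nonneg_eq_0_iff) auto
    have "w i * eta (t i) = 0" if "i \<in> I" for i using wt[OF that] by (auto simp: eta_def)
    then have "(\<Sum>i\<in>I. w i * eta (t i)) = 0" by (intro sum.neutral) simp
    then show ?thesis using True unfolding s_def[symmetric] by (simp add: eta_def)
  next
    case False
    then have s: "0 < s" using s0 by simp
    define c where "c = log 2 s + 1 / ln 2"
    have "(\<Sum>i\<in>I. w i * (eta s + c * (t i - s))) \<le> (\<Sum>i\<in>I. w i * eta (t i))"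
      unfolding c_def by (intro sum_mono mult_left_mono eta_tangent s t w)
    also have "(\<Sum>i\<in>I. w i * (eta s + c * (t i - s)))
        = (\<Sum>i\<in>I. w i) * (eta s - c * s) + c * (\<Sum>i\<in>I. w i * t i)"
      by (simp add: sum_distrib_left sum_distrib_right sum.distrib algebra_simps sum_subtractf)
    also have "\<dots> = eta s" unfolding w(2) s_def[symmetric] by simp
    finally show ?thesis by (simp add: s_def)
  qed
qed

lemma vn_entropy_unitary_diagonal:
  assumes "unitary_mat n U" "D \<in> carrier_mat n n" "diagonal_mat D"
  shows "vn_entropy (U * D * dagger U) = - (\<Sum>k<n. eta (Re (D $$ (k, k))))"
proof -
  have U: "U \<in> carrier_mat n n" "dagger U * U = 1\<^sub>m n" and dU: "dagger U \<in> carrier_mat n n"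
    using assms(1) by (auto simp: unitary_mat_def)
  have "vn_entropy (U * (D * dagger U)) = vn_entropy ((D * dagger U) * U)"
    using U assms(2) by (intro vn_entropy_mult_swap[of _ n n]) auto
  also have "(D * dagger U) * U = D" using U dU assms(2) by (simp add: assoc_mult_mat[of _ n n _ n _ n])
  also have "vn_entropy D = - (\<Sum>k<n. eta (Re (D $$ (k, k))))"
    using assms(2,3) by (intro vn_entropy_upper_triangular) (auto simp: diagonal_mat_def)
  finally show ?thesis using U dU assms(2) by (simp add: assoc_mult_mat[of _ n n _ n _ n])
qed

text \<open>A Gram factorization rather than a condition on quadratic forms: reduced density
  matrices come with one, and it turns diagonal entries into sums of squares.\<close>

definition psd :: "nat \<Rightarrow> complex mat \<Rightarrow> bool" where
  "psd n A \<longleftrightarrow> (\<exists>m X. X \<in> carrier_mat n m \<and> A = X * dagger X)"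

lemma psd_carrier: "psd n A \<Longrightarrow> A \<in> carrier_mat n n"
  by (auto simp: psd_def)

lemma mult_dagger_diag:
  assumes "X \<in> carrier_mat n m" "k < n"
  shows "(X * dagger X) $$ (k, k) = complex_of_real (\<Sum>j<m. (cmod (X $$ (k, j)))\<^sup>2)"
  using assms by (simp add: scalar_prod_def atLeast0LessThan complex_norm_square[symmetric])

lemma unitary_mat_sums:
  assumes "unitary_mat n W" "k < n"
  shows "(\<Sum>m<n. (cmod (W $$ (k, m)))\<^sup>2) = 1" "(\<Sum>m<n. (cmod (W $$ (m, k)))\<^sup>2) = 1"
proof -
  have *: "(\<Sum>m<n. (cmod (V $$ (k, m)))\<^sup>2) = 1" if "unitary_mat n V" for V
  proof -
    have "complex_of_real (\<Sum>m<n. (cmod (V $$ (k, m)))\<^sup>2) = 1"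
      using that assms(2) by (subst mult_dagger_diag[symmetric]) (auto simp: unitary_mat_def)
    then show ?thesis using of_real_eq_1_iff by blast
  qed
  show "(\<Sum>m<n. (cmod (W $$ (k, m)))\<^sup>2) = 1" using * assms(1) by blast
  have "W \<in> carrier_mat n n" using assms(1) by (simp add: unitary_mat_def)
  then show "(\<Sum>m<n. (cmod (W $$ (m, k)))\<^sup>2) = 1"
    using *[OF unitary_mat_dagger[OF assms(1)]] assms(2) by simp
qed

definition diag_real :: "nat \<Rightarrow> (nat \<Rightarrow> real) \<Rightarrow> complex mat" where
  "diag_real n d = mat n n (\<lambda>(i, j). if i = j then complex_of_real (d i) else 0)"

lemma diag_real_carrier [simp]: "diag_real n d \<in> carrier_mat n n"
  and diag_real_dim [simp]: "dim_row (diag_real n d) = n" "dim_col (diag_real n d) = n"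
  by (simp_all add: diag_real_def)

lemma psd_spectral:
  assumes "psd n A"
  obtains U d where "unitary_mat n U" "\<And>k. k < n \<Longrightarrow> 0 \<le> d k"
    "A = U * diag_real n d * dagger U" "vn_entropy A = - (\<Sum>k<n. eta (d k))"
proof -
  obtain m X where X: "X \<in> carrier_mat n m" "A = X * dagger X"
    using assms by (auto simp: psd_def)
  have A: "A \<in> carrier_mat n n" using X by simp
  have "dagger A = A" unfolding X(2) using X(1) by (simp add: dagger_mult[of _ n m _ n])
  then obtain U D where UD: "unitary_mat n U" "D \<in> carrier_mat n n" "diagonal_mat D" "A = U * D * dagger U"
    using hermitian_spectral[OF A] by blast
  have U: "U \<in> carrier_mat n n" "dagger U * U = 1\<^sub>m n" and dU: "dagger U \<in> carrier_mat n n"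
    using UD(1) by (auto simp: unitary_mat_def)
  \<comment> \<open>\<open>Y\<close> is the factor seen in the eigenbasis. The eigenvalues become
    squared row norms of \<open>Y\<close> and are therefore real and nonnegative.\<close>
  define Y where "Y = dagger U * X"
  have Y: "Y \<in> carrier_mat n m" using dU X by (simp add: Y_def)
  have c: "U * D \<in> carrier_mat n n" "U * D * dagger U \<in> carrier_mat n n" "D * dagger U \<in> carrier_mat n n"
    "dagger U * U \<in> carrier_mat n n"
    using U UD(2) dU by auto
  have "D = (dagger U * U) * D * (dagger U * U)" unfolding U(2) using UD(2) by simp
  also have "\<dots> = dagger U * A * U" unfolding UD(4) using U(1) UD(2) dU c
    by (simp add: assoc_mult_mat[of _ n n _ n _ n])
  also have "\<dots> = Y * dagger Y"
    unfolding X(2) Y_def dagger_mult[OF dU X(1)] using X(1) U(1) dU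
      mult_carrier_mat[OF dagger_carrier[OF X(1)] U(1)]
    by (simp add: assoc_mult_mat[of _ n m _ n _ n] assoc_mult_mat[of _ n n _ n _ n] assoc_mult_mat[of _ n n _ m _ n])
  finally have D: "D = Y * dagger Y" .
  define d where "d k = (\<Sum>j<m. (cmod (Y $$ (k, j)))\<^sup>2)" for k
  have Dd: "D $$ (k, k) = complex_of_real (d k)" if "k < n" for k
    using mult_dagger_diag[OF Y that] by (simp add: D d_def)
  have "D = diag_real n d"
    using UD(2,3) Dd by (intro eq_matI) (auto simp: diag_real_def diagonal_mat_def)
  moreover have "vn_entropy A = - (\<Sum>k<n. eta (d k))"
    unfolding UD(4) using vn_entropy_unitary_diagonal[OF UD(1-3)] Dd by simp
  moreover have "0 \<le> d k" for k by (simp add: d_def sum_nonneg)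
  ultimately show ?thesis using UD(1,4) by (intro that[of U d]) simp_all
qed

lemma conj_diag_index:
  assumes "A \<in> carrier_mat n n" "V \<in> carrier_mat n n" "k < n"
  shows "(dagger V * A * V) $$ (k, k) = (\<Sum>b<n. \<Sum>a<n. cnj (V $$ (a, k)) * A $$ (a, b) * V $$ (b, k))"
  using assms by (simp add: scalar_prod_def atLeast0LessThan sum_distrib_right)

text \<open>In the basis \<open>V\<close> each diagonal entry is an average of the eigenvalues
  \<open>d m\<close>. The weights are squared moduli of entries of the unitary
  \<open>dagger V * U\<close>, so they form a doubly stochastic matrix.\<close>

lemma conj_spectral_diag:
  assumes U: "unitary_mat n U" and V: "unitary_mat n V" and k: "k < n"
  shows "(dagger V * (U * diag_real n d * dagger U) * V) $$ (k, k) =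
    complex_of_real (\<Sum>m<n. (cmod ((dagger V * U) $$ (k, m)))\<^sup>2 * d m)"
proof -
  define W where "W = dagger V * U"
  have c: "U \<in> carrier_mat n n" "V \<in> carrier_mat n n" "dagger U \<in> carrier_mat n n" "dagger V \<in> carrier_mat n n"
    using U V by (auto simp: unitary_mat_def)
  have c': "diag_real n d * dagger U \<in> carrier_mat n n" "U * (diag_real n d * dagger U) \<in> carrier_mat n n"
    "U * diag_real n d * dagger U \<in> carrier_mat n n" "U * diag_real n d \<in> carrier_mat n n"
    "dagger U * V \<in> carrier_mat n n" "diag_real n d * (dagger U * V) \<in> carrier_mat n n"
    using c by (auto intro!: mult_carrier_mat[of _ n n _ n])
  have W: "W \<in> carrier_mat n n" unfolding W_def by (rule mult_carrier_mat[OF c(4) c(1)])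
  have "dagger V * (U * diag_real n d * dagger U) * V = W * diag_real n d * dagger W"
    unfolding W_def dagger_mult[OF c(4) c(1)] using c c'
    by (simp add: assoc_mult_mat[of _ n n _ n _ n])
  also have "(W * diag_real n d * dagger W) $$ (k, k)
      = (\<Sum>m<n. (W * diag_real n d) $$ (k, m) * cnj (W $$ (k, m)))"
    using W k by (simp add: scalar_prod_def atLeast0LessThan)
  also have "\<dots> = (\<Sum>m<n. W $$ (k, m) * complex_of_real (d m) * cnj (W $$ (k, m)))"
  proof (intro sum.cong refl)
    fix m assume "m \<in> {..<n}"
    then have "(W * diag_real n d) $$ (k, m) = (\<Sum>i<n. W $$ (k, i) * (if i = m then complex_of_real (d i) else 0))"
      using W k by (simp add: scalar_prod_def atLeast0LessThan diag_real_def)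
    also have "\<dots> = (\<Sum>i<n. if i = m then W $$ (k, i) * complex_of_real (d i) else 0)"
      by (intro sum.cong) auto
    finally show "(W * diag_real n d) $$ (k, m) * cnj (W $$ (k, m)) = W $$ (k, m) * complex_of_real (d m) * cnj (W $$ (k, m))"
      using \<open>m \<in> {..<n}\<close> by simp
  qed
  also have "\<dots> = complex_of_real (\<Sum>m<n. (cmod (W $$ (k, m)))\<^sup>2 * d m)"
    by (simp add: complex_norm_square[symmetric] ac_simps)
  finally show ?thesis unfolding W_def .
qed

text \<open>With \<open>V\<close> diagonalizing \<open>R\<close>, the eigenvalue \<open>r k\<close>
  is an average of all eigenvalues \<open>d j m\<close> with weights \<open>w k (j, m)\<close>.
  Jensen for fixed \<open>k\<close> uses that the rows of each unitary \<open>W j\<close> have norm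
  1. Summing over \<open>k\<close> afterwards leaves the weight \<open>p j\<close> on each
  \<open>eta (d j m)\<close>, because the columns have norm 1 too.\<close>

lemma vn_entropy_concave:
  assumes R: "psd n R" and J: "finite J" and rho: "\<And>j. j \<in> J \<Longrightarrow> psd n (\<rho> j)"
    and p: "\<And>j. j \<in> J \<Longrightarrow> 0 \<le> p j" "(\<Sum>j\<in>J. p j) = 1"
    and mix: "\<And>a b. a < n \<Longrightarrow> b < n \<Longrightarrow> R $$ (a, b) = (\<Sum>j\<in>J. complex_of_real (p j) * \<rho> j $$ (a, b))"
  shows "(\<Sum>j\<in>J. p j * vn_entropy (\<rho> j)) \<le> vn_entropy R"
proof -
  obtain V r where V: "unitary_mat n V" "R = V * diag_real n r * dagger V" "vn_entropy R = - (\<Sum>k<n. eta (r k))"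
    using psd_spectral[OF R] by metis
  have "\<forall>j. \<exists>U d. j \<in> J \<longrightarrow> unitary_mat n U \<and> (\<forall>k<n. 0 \<le> d k) \<and>
      \<rho> j = U * diag_real n d * dagger U \<and> vn_entropy (\<rho> j) = - (\<Sum>k<n. eta (d k))"
    using psd_spectral[OF rho] by metis
  then obtain U d where Ud: "\<And>j. j \<in> J \<Longrightarrow> unitary_mat n (U j)"
      "\<And>j k. j \<in> J \<Longrightarrow> k < n \<Longrightarrow> 0 \<le> d j k"
      "\<And>j. j \<in> J \<Longrightarrow> \<rho> j = U j * diag_real n (d j) * dagger (U j)"
      "\<And>j. j \<in> J \<Longrightarrow> vn_entropy (\<rho> j) = - (\<Sum>k<n. eta (d j k))"
    by metis
  have Vc: "V \<in> carrier_mat n n" using V by (simp add: unitary_mat_def)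
  define W where "W j = dagger V * U j" for j
  have W: "unitary_mat n (W j)" if "j \<in> J" for j
    unfolding W_def using V(1) Ud(1)[OF that] by (intro unitary_mat_mult unitary_mat_dagger)
  define w where "w k = (\<lambda>(j, m). p j * (cmod (W j $$ (k, m)))\<^sup>2)" for k
  have r: "r k = (\<Sum>x\<in>J \<times> {..<n}. w k x * (case x of (j, m) \<Rightarrow> d j m))" if k: "k < n" for k
  proof -
    have one: "dagger V * V = 1\<^sub>m n" using V(1) by (simp add: unitary_mat_def)
    have "(dagger V * R * V) $$ (k, k) = complex_of_real (\<Sum>m<n. (cmod ((1\<^sub>m n :: complex mat) $$ (k, m)))\<^sup>2 * r m)"
      unfolding V(2) using conj_spectral_diag[OF V(1) V(1) k, of r] unfolding one .
    also have "(\<Sum>m<n. (cmod ((1\<^sub>m n :: complex mat) $$ (k, m)))\<^sup>2 * r m) = (\<Sum>m<n. if k = m then r m else 0)"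
      using k by (intro sum.cong) auto
    also have "\<dots> = r k" using k by simp
    finally have "complex_of_real (r k) = (dagger V * R * V) $$ (k, k)" by simp
    also have "\<dots> = (\<Sum>b<n. \<Sum>a<n. cnj (V $$ (a, k)) * (\<Sum>j\<in>J. complex_of_real (p j) * \<rho> j $$ (a, b)) * V $$ (b, k))"
      unfolding conj_diag_index[OF psd_carrier[OF R] Vc k] by (simp add: mix)
    also have "\<dots> = (\<Sum>b<n. \<Sum>a<n. \<Sum>j\<in>J. complex_of_real (p j) * (cnj (V $$ (a, k)) * \<rho> j $$ (a, b) * V $$ (b, k)))"
      by (simp add: sum_distrib_left sum_distrib_right ac_simps)
    also have "\<dots> = (\<Sum>b<n. \<Sum>j\<in>J. \<Sum>a<n. complex_of_real (p j) * (cnj (V $$ (a, k)) * \<rho> j $$ (a, b) * V $$ (b, k)))"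
      by (intro sum.cong refl sum.swap)
    also have "\<dots> = (\<Sum>j\<in>J. \<Sum>b<n. \<Sum>a<n. complex_of_real (p j) * (cnj (V $$ (a, k)) * \<rho> j $$ (a, b) * V $$ (b, k)))"
      by (rule sum.swap)
    also have "\<dots> = (\<Sum>j\<in>J. complex_of_real (p j) * (dagger V * \<rho> j * V) $$ (k, k))"
      using conj_diag_index[OF psd_carrier[OF rho] Vc k] by (simp add: sum_distrib_left)
    also have "\<dots> = (\<Sum>j\<in>J. complex_of_real (p j * (\<Sum>m<n. (cmod (W j $$ (k, m)))\<^sup>2 * d j m)))"
    proof (intro sum.cong refl)
      fix j assume j: "j \<in> J"
      have "(dagger V * \<rho> j * V) $$ (k, k) = complex_of_real (\<Sum>m<n. (cmod (W j $$ (k, m)))\<^sup>2 * d j m)"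
        unfolding W_def Ud(3)[OF j] by (rule conj_spectral_diag[OF Ud(1)[OF j] V(1) k])
      then show "complex_of_real (p j) * (dagger V * \<rho> j * V) $$ (k, k)
          = complex_of_real (p j * (\<Sum>m<n. (cmod (W j $$ (k, m)))\<^sup>2 * d j m))" by simp
    qed
    also have "\<dots> = complex_of_real (\<Sum>j\<in>J. \<Sum>m<n. w k (j, m) * d j m)"
      by (simp add: w_def sum_distrib_left mult.assoc)
    finally have "r k = (\<Sum>j\<in>J. \<Sum>m<n. w k (j, m) * d j m)" using of_real_eq_iff by blast
    then show ?thesis by (simp add: sum.cartesian_product split_def)
  qed
  have le: "eta (r k) \<le> (\<Sum>x\<in>J \<times> {..<n}. w k x * eta (case x of (j, m) \<Rightarrow> d j m))" if k: "k < n" for k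
    unfolding r[OF k]
  proof (rule eta_jensen)
    have "(\<Sum>x\<in>J \<times> {..<n}. w k x) = (\<Sum>j\<in>J. p j * (\<Sum>m<n. (cmod (W j $$ (k, m)))\<^sup>2))"
      by (simp add: w_def sum_distrib_left sum.cartesian_product split_def)
    also have "\<dots> = 1" using unitary_mat_sums(1)[OF W k] p(2) by simp
    finally show "(\<Sum>x\<in>J \<times> {..<n}. w k x) = 1" .
  qed (use J p Ud(2) in \<open>auto simp: w_def\<close>)
  have "(\<Sum>k<n. eta (r k)) \<le> (\<Sum>k<n. \<Sum>x\<in>J \<times> {..<n}. w k x * eta (case x of (j, m) \<Rightarrow> d j m))"
    using le by (intro sum_mono) auto
  also have "\<dots> = (\<Sum>x\<in>J \<times> {..<n}. \<Sum>k<n. w k x * eta (case x of (j, m) \<Rightarrow> d j m))"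
    by (rule sum.swap)
  also have "\<dots> = (\<Sum>j\<in>J. \<Sum>m<n. p j * (\<Sum>k<n. (cmod (W j $$ (k, m)))\<^sup>2) * eta (d j m))"
    by (subst sum.cartesian_product') (simp add: w_def sum_distrib_left sum_distrib_right mult.assoc)
  also have "\<dots> = (\<Sum>j\<in>J. p j * (\<Sum>m<n. eta (d j m)))"
    using unitary_mat_sums(2)[OF W] by (simp add: sum_distrib_left)
  also have "\<dots> = - (\<Sum>j\<in>J. p j * vn_entropy (\<rho> j))"
    using Ud(4) by (simp add: sum_negf)
  finally show ?thesis using V(3) by simp
qed

text \<open>Nonnegative eigenvalues with sum 1 lie in [0, 1], where \<open>eta\<close> is
  nonpositive.\<close>

lemma vn_entropy_nonneg:
  assumes psd: "psd n A" and tr: "(\<Sum>k<n. A $$ (k, k)) = 1"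
  shows "0 \<le> vn_entropy A"
proof -
  obtain U d where U: "unitary_mat n U" "\<And>k. k < n \<Longrightarrow> 0 \<le> d k"
    "A = U * diag_real n d * dagger U" "vn_entropy A = - (\<Sum>k<n. eta (d k))"
    using psd_spectral[OF psd] by metis
  \<comment> \<open>With the identity as second basis, the diagonal of \<open>A\<close> itself is
    expressed by the eigenvalues, so unit trace says that they sum to 1.\<close>
  have one: "unitary_mat n (1\<^sub>m n)" by (simp add: unitary_mat_def)
  have Uc: "U \<in> carrier_mat n n" "dagger U \<in> carrier_mat n n" using U(1) by (auto simp: unitary_mat_def)
  have "A $$ (k, k) = complex_of_real (\<Sum>m<n. (cmod (U $$ (k, m)))\<^sup>2 * d m)" if "k < n" for k
    using conj_spectral_diag[OF U(1) one that, of d] psd_carrier[OF psd] Uc unfolding U(3)[symmetric] by simp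
  then have "complex_of_real (\<Sum>k<n. \<Sum>m<n. (cmod (U $$ (k, m)))\<^sup>2 * d m) = 1"
    using tr by simp
  then have "(\<Sum>k<n. \<Sum>m<n. (cmod (U $$ (k, m)))\<^sup>2 * d m) = 1" using of_real_eq_1_iff by blast
  moreover have "(\<Sum>k<n. \<Sum>m<n. (cmod (U $$ (k, m)))\<^sup>2 * d m) = (\<Sum>m<n. \<Sum>k<n. (cmod (U $$ (k, m)))\<^sup>2 * d m)"
    by (rule sum.swap)
  ultimately have sum1: "(\<Sum>m<n. d m) = 1"
    using unitary_mat_sums(2)[OF U(1)] by (simp flip: sum_distrib_right)
  have "eta (d k) \<le> 0" if k: "k < n" for k
  proof -
    have "d k \<le> (\<Sum>m<n. d m)" using k U(2) by (intro member_le_sum) auto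
    then show ?thesis using sum1 by (auto simp: eta_def mult_le_0_iff)
  qed
  then have "(\<Sum>k<n. eta (d k)) \<le> 0" by (intro sum_nonpos) auto
  then show ?thesis by (simp add: U(4))
qed

section \<open>Entanglement entropy under LOCC\<close>

text \<open>\<open>R\<close> is \<open>R'\<close> relabelled along \<open>\<iota>\<close> and padded
  with zero rows and columns, that is \<open>V * (R' * dagger V)\<close> for an isometry
  \<open>V\<close>; swapping the factors cancels \<open>V\<close>.\<close>

lemma vn_entropy_reindex:
  assumes R: "R \<in> carrier_mat n n" and R': "R' \<in> carrier_mat n' n'"
    and S: "S \<subseteq> {..<n}" and bij: "bij_betw \<iota> S {..<n'}"
    and eq: "\<And>j k. j < n \<Longrightarrow> k < n \<Longrightarrow>
      R $$ (j, k) = (if j \<in> S \<and> k \<in> S then R' $$ (\<iota> j, \<iota> k) else 0)"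
  shows "vn_entropy R = vn_entropy R'"
proof -
  define V :: "complex mat" where "V = mat n n' (\<lambda>(j, m). if j \<in> S \<and> \<iota> j = m then 1 else 0)"
  have V: "V \<in> carrier_mat n n'" and dV: "dagger V \<in> carrier_mat n' n"
    by (auto simp: V_def dagger_def)
  have \<iota>: "\<iota> j < n'" if "j \<in> S" for j using bij that by (auto simp: bij_betw_def)
  have "R = V * (R' * dagger V)"
  proof (intro eq_matI)
    fix j k assume "j < dim_row (V * (R' * dagger V))" "k < dim_col (V * (R' * dagger V))"
    then have jk: "j < n" "k < n" using V R' dV by auto
    have 1: "(R' * dagger V) $$ (m, k) = (if k \<in> S then R' $$ (m, \<iota> k) else 0)" if m: "m < n'" for m
    proof -
      have "(R' * dagger V) $$ (m, k) = (\<Sum>l<n'. R' $$ (m, l) * cnj (if k \<in> S \<and> \<iota> k = l then 1 else 0))"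
        using m jk R' by (simp add: scalar_prod_def atLeast0LessThan V_def)
      also have "\<dots> = (\<Sum>l<n'. if l = \<iota> k then (if k \<in> S then R' $$ (m, l) else 0) else 0)"
        by (intro sum.cong) auto
      also have "\<dots> = (if k \<in> S then R' $$ (m, \<iota> k) else 0)" using \<iota>[of k] by auto
      finally show ?thesis .
    qed
    have "(V * (R' * dagger V)) $$ (j, k) = (\<Sum>m<n'. (if j \<in> S \<and> \<iota> j = m then 1 else 0) * (R' * dagger V) $$ (m, k))"
      using jk V R' dV by (simp add: scalar_prod_def atLeast0LessThan V_def)
    also have "\<dots> = (\<Sum>m<n'. if m = \<iota> j then (if j \<in> S \<and> k \<in> S then R' $$ (m, \<iota> k) else 0) else 0)"
      by (intro sum.cong) (auto simp: 1)
    also have "\<dots> = R $$ (j, k)" using \<iota>[of j] eq[OF jk] by auto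
    finally show "R $$ (j, k) = (V * (R' * dagger V)) $$ (j, k)" by simp
  qed (use R V R' dV in auto)
  moreover have "dagger V * V = 1\<^sub>m n'"
  proof (intro eq_matI)
    fix a b assume "a < dim_row (1\<^sub>m n')" "b < dim_col (1\<^sub>m n')"
    then have ab: "a < n'" "b < n'" by auto
    have "(dagger V * V) $$ (a, b) = (\<Sum>j<n. cnj (if j \<in> S \<and> \<iota> j = a then 1 else 0) * (if j \<in> S \<and> \<iota> j = b then 1 else 0))"
      using ab by (simp add: scalar_prod_def atLeast0LessThan V_def)
    also have "\<dots> = (\<Sum>j\<in>S. if \<iota> j = a \<and> a = b then 1 else 0)"
      using S by (intro sum.mono_neutral_cong_right) auto
    also have "\<dots> = (\<Sum>m<n'. if m = a \<and> a = b then 1 else 0)"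
      by (rule sum.reindex_bij_betw[OF bij])
    also have "\<dots> = (if a = b then 1 else 0)" using ab by auto
    finally show "(dagger V * V) $$ (a, b) = 1\<^sub>m n' $$ (a, b)" using ab by simp
  qed (use V in auto)
  ultimately have "vn_entropy R = vn_entropy ((R' * dagger V) * V)"
    using V dV R' vn_entropy_mult_swap[OF V, of "R' * dagger V"] by simp
  also have "(R' * dagger V) * V = R'"
    using assoc_mult_mat[OF R' dV V] \<open>dagger V * V = 1\<^sub>m n'\<close> R' by simp
  finally show ?thesis .
qed

lemma finite_cfgs_on [simp]: "finite S \<Longrightarrow> finite (cfgs_on S)"
  and card_cfgs_on: "finite S \<Longrightarrow> card (cfgs_on S) = 2 ^ card S"
proof -
  assume S: "finite S"
  have "bij_betw Collect (cfgs_on S) (Pow S)"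
    by (rule bij_betw_byWitness[where f' = "\<lambda>X q. q \<in> X"]) (auto simp: cfgs_on_def)
  then show "finite (cfgs_on S)" "card (cfgs_on S) = 2 ^ card S"
    using S by (auto simp: bij_betw_finite bij_betw_same_card card_Pow)
qed

lemma cfg_of_bij:
  assumes A: "finite A"
  shows "bij_betw (cfg_of A) {..<2 ^ card A} (cfgs_on A)"
proof -
  let ?l = "sorted_list_of_set A"
  have len: "length ?l = card A" using A by simp
  have nth: "cfg_of A j (?l ! k) = bit j k" if "k < card A" for j k
    using that len distinct_sorted_list_of_set[of A] unfolding cfg_of_def by (metis nth_eq_iff_index_eq)
  have inj: "inj_on (cfg_of A) {..<2 ^ card A}"
  proof (intro inj_onI bit_eqI)
    fix i j k assume ij: "i \<in> {..<2 ^ card A}" "j \<in> {..<2 ^ card A}" "cfg_of A i = cfg_of A j"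
    show "bit i k = bit j k"
    proof (cases "k < card A")
      case True
      then show ?thesis using nth[OF True, of i] nth[OF True, of j] ij(3) by simp
    next
      case False
      then have le: "(2::nat) ^ card A \<le> 2 ^ k" by (intro power_increasing) auto
      have "i < 2 ^ k" "j < 2 ^ k" using ij(1,2) less_le_trans[OF _ le] by blast+
      then show ?thesis by (simp add: bit_iff_odd)
    qed
  qed
  have "cfg_of A ` {..<2 ^ card A} \<subseteq> cfgs_on A"
  proof -
    have "?l ! k \<in> A" if "k < card A" for k
      using that len A nth_mem[of k ?l] by simp
    then show ?thesis by (auto simp: cfgs_on_def cfg_of_def)
  qed
  \<comment> \<open>Surjectivity by counting: both sets have \<open>2 ^ card A\<close>
    elements.\<close>
  then have "cfg_of A ` {..<2 ^ card A} = cfgs_on A"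
    using A inj by (intro card_subset_eq) (auto simp: card_cfgs_on card_image)
  with inj show ?thesis by (simp add: bij_betw_def)
qed

lemma glue_bij:
  assumes "A \<inter> B = {}"
  shows "bij_betw (\<lambda>(x, z). glue A x z) (cfgs_on A \<times> cfgs_on B) (cfgs_on (A \<union> B))"
  by (rule bij_betw_byWitness[where f' = "\<lambda>y. (\<lambda>q. q \<in> A \<and> y q, \<lambda>q. q \<in> B \<and> y q)"])
     (use assms in \<open>auto simp: cfgs_on_def glue_def fun_eq_iff\<close>)

lemma glue_in_cfgs_on: "x \<in> cfgs_on A \<Longrightarrow> z \<in> cfgs_on B \<Longrightarrow> glue A x z \<in> cfgs_on (A \<union> B)"
  by (simp add: cfgs_on_def glue_def)

lemma glue_commute:
  assumes "x \<in> cfgs_on A" "z \<in> cfgs_on B" "A \<inter> B = {}"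
  shows "glue B z x = glue A x z"
  using assms by (auto simp: cfgs_on_def glue_def fun_eq_iff)

section \<open>Amplitude matrices and the two marginals\<close>

text \<open>The state reshaped into a matrix across the cut; for a normalized state its singular
  values are the Schmidt coefficients.\<close>

definition amp :: "nat \<Rightarrow> nat set \<Rightarrow> (cfg \<Rightarrow> complex) \<Rightarrow> complex mat" where
  "amp N A \<psi> = mat (2 ^ card A) (2 ^ card ({0..<N} - A))
     (\<lambda>(j, k). \<psi> (glue A (cfg_of A j) (cfg_of ({0..<N} - A) k)))"

lemma reduced_dm_carrier: "reduced_dm N A \<psi> \<in> carrier_mat (2 ^ card A) (2 ^ card A)"
  by (simp add: reduced_dm_def)

lemma amp_carrier: "amp N A \<psi> \<in> carrier_mat (2 ^ card A) (2 ^ card ({0..<N} - A))"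
  by (simp add: amp_def)

lemma reduced_dm_amp: "reduced_dm N A \<psi> = amp N A \<psi> * dagger (amp N A \<psi>)"
proof (intro eq_matI)
  fix j k assume "j < dim_row (amp N A \<psi> * dagger (amp N A \<psi>))" "k < dim_col (amp N A \<psi> * dagger (amp N A \<psi>))"
  then have jk: "j < 2 ^ card A" "k < 2 ^ card A" by (auto simp: amp_def)
  let ?B = "{0..<N} - A"
  have "(amp N A \<psi> * dagger (amp N A \<psi>)) $$ (j, k) = (\<Sum>l<2 ^ card ?B.
      \<psi> (glue A (cfg_of A j) (cfg_of ?B l)) * cnj (\<psi> (glue A (cfg_of A k) (cfg_of ?B l))))"
    using jk by (simp add: scalar_prod_def atLeast0LessThan amp_def)
  also have "\<dots> = (\<Sum>z\<in>cfgs_on ?B. \<psi> (glue A (cfg_of A j) z) * cnj (\<psi> (glue A (cfg_of A k) z)))"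
    by (rule sum.reindex_bij_betw[OF cfg_of_bij]) simp
  finally show "reduced_dm N A \<psi> $$ (j, k) = (amp N A \<psi> * dagger (amp N A \<psi>)) $$ (j, k)"
    using jk by (simp add: reduced_dm_def)
qed (auto simp: reduced_dm_def amp_def)

lemma psd_reduced_dm: "psd (2 ^ card A) (reduced_dm N A \<psi>)"
  unfolding psd_def reduced_dm_amp using amp_carrier by blast

text \<open>Exchanging the sides transposes the amplitude matrix M. The other marginal is M^T
  conj(M), and swapping its factors gives conj(M) M^T, the transpose of M M^dagger.\<close>

lemma ent_entropy_complement:
  assumes A: "A \<subseteq> {0..<N}"
  shows "ent_entropy N ({0..<N} - A) \<psi> = ent_entropy N A \<psi>"
proof -
  let ?B = "{0..<N} - A"
  let ?M = "amp N A \<psi>"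
  have fin: "finite A" "finite ?B" using A finite_subset by auto
  have AB: "{0..<N} - ?B = A" using A by auto
  have M: "?M \<in> carrier_mat (2 ^ card A) (2 ^ card ?B)" by (rule amp_carrier)
  have tM: "amp N ?B \<psi> = transpose_mat ?M"
  proof (intro eq_matI)
    fix j k assume "j < dim_row (transpose_mat ?M)" "k < dim_col (transpose_mat ?M)"
    then have jk: "j < 2 ^ card ?B" "k < 2 ^ card A" by (auto simp: amp_def)
    then have "cfg_of ?B j \<in> cfgs_on ?B" "cfg_of A k \<in> cfgs_on A"
      using cfg_of_bij[OF fin(1)] cfg_of_bij[OF fin(2)] by (auto simp: bij_betw_def)
    then have "glue ?B (cfg_of ?B j) (cfg_of A k) = glue A (cfg_of A k) (cfg_of ?B j)"
      by (intro glue_commute) auto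
    then show "amp N ?B \<psi> $$ (j, k) = transpose_mat ?M $$ (j, k)"
      using jk by (simp add: amp_def AB)
  qed (auto simp: amp_def AB)
  have "ent_entropy N ?B \<psi> = vn_entropy (transpose_mat ?M * dagger (transpose_mat ?M))"
    by (simp add: ent_entropy_def reduced_dm_amp tM)
  also have "\<dots> = vn_entropy (dagger (transpose_mat ?M) * transpose_mat ?M)"
    using M by (intro vn_entropy_mult_swap[of _ "2 ^ card ?B" "2 ^ card A"]) auto
  also have "dagger (transpose_mat ?M) * transpose_mat ?M = transpose_mat (?M * dagger ?M)"
  proof -
    have "dagger (transpose_mat ?M) = map_mat cnj ?M" by (intro eq_matI) auto
    moreover have "transpose_mat (dagger ?M) = map_mat cnj ?M" by (simp add: dagger_def)
    ultimately show ?thesis using transpose_mult[OF M dagger_carrier[OF M]] by simp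
  qed
  also have "vn_entropy \<dots> = vn_entropy (?M * dagger ?M)"
    using M by (intro vn_entropy_transpose[of _ "2 ^ card A"]) auto
  finally show ?thesis by (simp add: ent_entropy_def reduced_dm_amp)
qed

lemma vnorm_square: "(vnorm N v)\<^sup>2 = (\<Sum>x\<in>cfgs N. (cmod (v x))\<^sup>2)"
  by (simp add: vnorm_def sum_nonneg)

lemma trace_reduced_dm:
  assumes A: "A \<subseteq> {0..<N}"
  shows "(\<Sum>j<2 ^ card A. reduced_dm N A \<psi> $$ (j, j)) = complex_of_real ((vnorm N \<psi>)\<^sup>2)"
proof -
  let ?B = "{0..<N} - A"
  have fin: "finite A" using A finite_subset by auto
  have AB: "A \<union> ?B = {0..<N}" using A by auto
  have "(\<Sum>j<2 ^ card A. reduced_dm N A \<psi> $$ (j, j))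
      = (\<Sum>j<2 ^ card A. \<Sum>z\<in>cfgs_on ?B. complex_of_real ((cmod (\<psi> (glue A (cfg_of A j) z)))\<^sup>2))"
    by (intro sum.cong) (auto simp: reduced_dm_def complex_norm_square[symmetric])
  also have "\<dots> = (\<Sum>x\<in>cfgs_on A. \<Sum>z\<in>cfgs_on ?B. complex_of_real ((cmod (\<psi> (glue A x z)))\<^sup>2))"
    by (rule sum.reindex_bij_betw[OF cfg_of_bij[OF fin]])
  also have "\<dots> = (\<Sum>y\<in>cfgs_on A \<times> cfgs_on ?B. complex_of_real ((cmod (\<psi> ((\<lambda>(x, z). glue A x z) y)))\<^sup>2))"
    by (simp add: sum.cartesian_product split_def)
  also have "\<dots> = (\<Sum>x\<in>cfgs N. complex_of_real ((cmod (\<psi> x))\<^sup>2))"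
    using sum.reindex_bij_betw[OF glue_bij[of A ?B], of "\<lambda>x. complex_of_real ((cmod (\<psi> x))\<^sup>2)"]
    unfolding AB by auto
  finally show ?thesis by (simp add: vnorm_square)
qed

lemma ent_entropy_nonneg:
  assumes "A \<subseteq> {0..<N}" "vnorm N \<psi> = 1"
  shows "0 \<le> ent_entropy N A \<psi>"
  unfolding ent_entropy_def
  using trace_reduced_dm[OF assms(1), of \<psi>] assms(2) by (intro vn_entropy_nonneg[OF psd_reduced_dm]) simp

section \<open>Local measurements and protocols\<close>

lemma sum_cfgs_on_split:
  assumes "finite B" "i \<in> B"
  shows "(\<Sum>z\<in>cfgs_on B. f z) = (\<Sum>z\<in>cfgs_on (B - {i}). \<Sum>b\<in>UNIV. f (z(i := b)))"
proof -
  have bij: "bij_betw (\<lambda>(z, b). z(i := b)) (cfgs_on (B - {i}) \<times> UNIV) (cfgs_on B)"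
    by (rule bij_betw_byWitness[where f' = "\<lambda>y. (y(i := False), y i)"])
       (use assms in \<open>auto simp: cfgs_on_def fun_eq_iff split: if_splits\<close>)
  have "(\<Sum>z\<in>cfgs_on B. f z) = (\<Sum>p\<in>cfgs_on (B - {i}) \<times> UNIV. f ((\<lambda>(z, b). z(i := b)) p))"
    by (rule sum.reindex_bij_betw[OF bij, symmetric])
  then show ?thesis by (simp add: sum.cartesian_product split_def)
qed

lemma kraus_completeD:
  assumes "kraus_complete Ks"
  shows "(\<Sum>l<length Ks. \<Sum>b\<in>UNIV. (Ks ! l) b a * cnj ((Ks ! l) b c)) = (if a = c then 1 else 0)"
proof -
  have "(\<Sum>K\<leftarrow>Ks. \<Sum>b\<in>UNIV. cnj (K b c) * K b a) = (if c = a then 1 else 0)"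
    using assms by (simp add: kraus_complete_def)
  then show ?thesis
    by (simp add: sum_list_sum_nth atLeast0LessThan mult.commute eq_commute)
qed

text \<open>No-signalling: qubit \<open>i\<close> is traced out, so its bit is summed over, which
  combines the two occurrences of each Kraus operator K into K^dagger K; completeness then removes
  the operators.\<close>

lemma reduced_dm_kraus_sum:
  assumes Ks: "kraus_complete Ks" and i: "i < N" "i \<notin> A" and jk: "j < 2 ^ card A" "k < 2 ^ card A"
  shows "(\<Sum>l<length Ks. reduced_dm N A (apply_local i (Ks ! l) \<psi>) $$ (j, k)) = reduced_dm N A \<psi> $$ (j, k)"
proof -
  let ?B = "{0..<N} - A"
  define x where "x = cfg_of A j"
  define y where "y = cfg_of A k"
  define f where "f z a = \<psi> (glue A x (z(i := a)))" for z a
  define g where "g z a = cnj (\<psi> (glue A y (z(i := a))))" for z a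
  have upd: "(glue A u (z(i := b)))(i := a) = glue A u (z(i := a))" "glue A u (z(i := b)) i = b" for u z a b
    using i by (auto simp: glue_def fun_eq_iff)
  \<comment> \<open>The inner sum over \<open>b\<close> is the entry (c, a) of K^dagger K, isolated
    as the only factor that depends on the outcome.\<close>
  have al: "reduced_dm N A (apply_local i K \<psi>) $$ (j, k) = (\<Sum>z\<in>cfgs_on (?B - {i}). \<Sum>a\<in>UNIV. \<Sum>c\<in>UNIV.
      f z a * g z c * (\<Sum>b\<in>UNIV. K b a * cnj (K b c)))" for K
  proof -
    have "reduced_dm N A (apply_local i K \<psi>) $$ (j, k) = (\<Sum>z\<in>cfgs_on (?B - {i}). \<Sum>b\<in>UNIV.
        (\<Sum>a\<in>UNIV. K b a * f z a) * (\<Sum>c\<in>UNIV. cnj (K b c) * g z c))"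
      using i jk by (simp add: reduced_dm_def sum_cfgs_on_split[of ?B i] apply_local_def upd x_def y_def f_def g_def)
    also have "\<dots> = (\<Sum>z\<in>cfgs_on (?B - {i}). \<Sum>a\<in>UNIV. \<Sum>c\<in>UNIV.
      f z a * g z c * (\<Sum>b\<in>UNIV. K b a * cnj (K b c)))"
      by (rule sum.cong[OF refl]) (simp add: UNIV_bool algebra_simps)
    finally show ?thesis .
  qed
  have "(\<Sum>l<length Ks. reduced_dm N A (apply_local i (Ks ! l) \<psi>) $$ (j, k)) =
     (\<Sum>z\<in>cfgs_on (?B - {i}). \<Sum>l<length Ks. \<Sum>a\<in>UNIV. \<Sum>c\<in>UNIV.
      f z a * g z c * (\<Sum>b\<in>UNIV. (Ks ! l) b a * cnj ((Ks ! l) b c)))"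
    unfolding al by (rule sum.swap)
  also have "\<dots> = (\<Sum>z\<in>cfgs_on (?B - {i}). \<Sum>a\<in>UNIV. \<Sum>c\<in>UNIV. \<Sum>l<length Ks.
      f z a * g z c * (\<Sum>b\<in>UNIV. (Ks ! l) b a * cnj ((Ks ! l) b c)))"
    by (subst sum.swap, subst (2) sum.swap) (rule refl)
  also have "\<dots> = (\<Sum>z\<in>cfgs_on (?B - {i}). \<Sum>a\<in>UNIV. \<Sum>c\<in>UNIV. f z a * g z c * (if a = c then 1 else 0))"
    unfolding sum_distrib_left[symmetric] kraus_completeD[OF Ks] ..
  also have "\<dots> = (\<Sum>z\<in>cfgs_on (?B - {i}). \<Sum>a\<in>UNIV. f z a * g z a)"
    by (rule sum.cong[OF refl]) (simp add: UNIV_bool)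
  also have "\<dots> = reduced_dm N A \<psi> $$ (j, k)"
    using i jk by (simp add: reduced_dm_def sum_cfgs_on_split[of ?B i] x_def y_def f_def g_def)
  finally show ?thesis .
qed

text \<open>For the empty set the reduced density matrix is 1x1 with the squared norm as its entry,
  so conservation of probability is the degenerate case of no-signalling.\<close>

lemma kraus_probabilities_sum:
  assumes Ks: "kraus_complete Ks" and i: "i < N"
  shows "(\<Sum>l<length Ks. (vnorm N (apply_local i (Ks ! l) \<psi>))\<^sup>2) = (vnorm N \<psi>)\<^sup>2"
proof -
  have "complex_of_real (\<Sum>l<length Ks. (vnorm N (apply_local i (Ks ! l) \<psi>))\<^sup>2)
      = (\<Sum>l<length Ks. \<Sum>j<2 ^ card ({} :: nat set). reduced_dm N {} (apply_local i (Ks ! l) \<psi>) $$ (j, j))"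
    by (subst trace_reduced_dm) auto
  also have "\<dots> = (\<Sum>j<2 ^ card ({} :: nat set). reduced_dm N {} \<psi> $$ (j, j))"
    using reduced_dm_kraus_sum[OF Ks i, of "{}"] by (subst sum.swap) simp
  also have "\<dots> = complex_of_real ((vnorm N \<psi>)\<^sup>2)" by (subst trace_reduced_dm) auto
  finally show ?thesis using of_real_eq_iff by blast
qed

lemma vnorm_normalize_vec: "vnorm N v \<noteq> 0 \<Longrightarrow> vnorm N (normalize_vec N v) = 1"
proof -
  assume nz: "vnorm N v \<noteq> 0"
  have "(vnorm N (normalize_vec N v))\<^sup>2 = (1 / vnorm N v)\<^sup>2 * (vnorm N v)\<^sup>2"
    unfolding vnorm_square[of N "normalize_vec N v"] vnorm_square[of N v] sum_distrib_left
    by (intro sum.cong) (simp_all add: normalize_vec_def norm_mult norm_divide power_divide power_mult_distrib)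
  also have "\<dots> = 1" using nz by (simp add: power_divide)
  finally have "(vnorm N (normalize_vec N v))\<^sup>2 = 1" .
  moreover have "0 \<le> vnorm N (normalize_vec N v)" by (simp add: vnorm_def sum_nonneg)
  ultimately show ?thesis by (simp add: power2_eq_1_iff)
qed

lemma reduced_dm_normalize_vec:
  assumes A: "A \<subseteq> {0..<N}" and jk: "j < 2 ^ card A" "k < 2 ^ card A"
  shows "reduced_dm N A v $$ (j, k) = complex_of_real ((vnorm N v)\<^sup>2) * reduced_dm N A (normalize_vec N v) $$ (j, k)"
proof (cases "vnorm N v = 0")
  case True
  \<comment> \<open>An outcome of probability zero has vanishing amplitudes, so both sides are 0,
    whatever \<open>normalize_vec\<close> yields.\<close>
  have "(\<Sum>x\<in>cfgs N. (cmod (v x))\<^sup>2) = 0" using True vnorm_square[of N v] by simp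
  then have v0: "v x = 0" if "x \<in> cfgs N" for x
    using that by (subst (asm) sum_nonneg_eq_0_iff) auto
  have fin: "finite A" using A finite_subset by auto
  have "cfg_of A j \<in> cfgs_on A" using cfg_of_bij[OF fin] jk by (auto simp: bij_betw_def)
  then have "glue A (cfg_of A j) z \<in> cfgs N" if "z \<in> cfgs_on ({0..<N} - A)" for z
    using glue_in_cfgs_on[OF _ that, of _ A] A by (simp add: Un_absorb1)
  then show ?thesis using True jk by (simp add: reduced_dm_def v0)
next
  case False
  then show ?thesis using jk
    by (simp add: reduced_dm_def normalize_vec_def sum_distrib_left power2_eq_square)
qed

text \<open>Positive semidefiniteness of \<open>reduced_dm\<close> is independent of normalization,
  so outcomes of probability zero can stay in the average with weight 0.\<close>

lemma ent_entropy_local_instrument: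
  assumes Ks: "kraus_complete Ks" and i: "i < N" and A: "A \<subseteq> {0..<N}" and \<psi>: "vnorm N \<psi> = 1"
  shows "(\<Sum>l<length Ks. (vnorm N (apply_local i (Ks ! l) \<psi>))\<^sup>2 *
    ent_entropy N A (normalize_vec N (apply_local i (Ks ! l) \<psi>))) \<le> ent_entropy N A \<psi>"
proof -
  have *: "(\<Sum>l<length Ks. (vnorm N (apply_local i (Ks ! l) \<psi>))\<^sup>2 *
    ent_entropy N A (normalize_vec N (apply_local i (Ks ! l) \<psi>))) \<le> ent_entropy N A \<psi>"
    if A: "A \<subseteq> {0..<N}" and iA: "i \<notin> A" for A
    unfolding ent_entropy_def
  proof (rule vn_entropy_concave[OF psd_reduced_dm _ psd_reduced_dm])
    show "(\<Sum>l<length Ks. (vnorm N (apply_local i (Ks ! l) \<psi>))\<^sup>2) = 1"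
      using kraus_probabilities_sum[OF Ks i] \<psi> by simp
    fix a b :: nat assume ab: "a < 2 ^ card A" "b < 2 ^ card A"
    show "reduced_dm N A \<psi> $$ (a, b) = (\<Sum>l<length Ks. complex_of_real ((vnorm N (apply_local i (Ks ! l) \<psi>))\<^sup>2) *
        reduced_dm N A (normalize_vec N (apply_local i (Ks ! l) \<psi>)) $$ (a, b))"
      unfolding reduced_dm_normalize_vec[OF A ab, symmetric] reduced_dm_kraus_sum[OF Ks i iA ab] ..
  qed auto
  show ?thesis
  proof (cases "i \<in> A")
    case False
    then show ?thesis using * A by blast
  next
    case True
    then show ?thesis using *[of "{0..<N} - A"] by (simp add: ent_entropy_complement[OF A])
  qed
qed

lemma ent_entropy_phase:
  assumes "cmod c = 1"
  shows "ent_entropy N A (\<lambda>x. c * \<phi> x) = ent_entropy N A \<phi>"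
proof -
  have "c * cnj c = 1" using assms by (simp add: complex_norm_square[symmetric])
  then have cancel: "c * a * (cnj c * b) = a * b" for a b by (metis (no_types, opaque_lifting) mult.assoc mult.commute mult_1)
  have "reduced_dm N A (\<lambda>x. c * \<phi> x) = reduced_dm N A \<phi>"
    by (simp add: reduced_dm_def cancel)
  then show ?thesis by (simp add: ent_entropy_def)
qed

text \<open>Induction on the protocol. Every branch ends in the same \<open>\<phi>\<close>, so the
  average final entropy is the entropy of \<open>\<phi>\<close>; this is where determinism
  enters.\<close>

lemma ent_entropy_locc_mono:
  assumes "locc_conv N \<psi> \<phi>" "vnorm N \<psi> = 1" "A \<subseteq> {0..<N}"
  shows "ent_entropy N A \<phi> \<le> ent_entropy N A \<psi>"
  using assms
proof (induction rule: locc_conv.induct)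
  case (locc_done c \<psi> \<phi>)
  then show ?case by (simp add: ent_entropy_phase)
next
  case (locc_step i Ks \<psi> \<phi>)
  let ?v = "\<lambda>l. apply_local i (Ks ! l) \<psi>"
  have "ent_entropy N A \<phi> = (\<Sum>l<length Ks. (vnorm N (?v l))\<^sup>2 * ent_entropy N A \<phi>)"
    using kraus_probabilities_sum[OF locc_step(2,1), of \<psi>] locc_step.prems(1)
    by (simp flip: sum_distrib_right)
  also have "\<dots> \<le> (\<Sum>l<length Ks. (vnorm N (?v l))\<^sup>2 * ent_entropy N A (normalize_vec N (?v l)))"
  proof (intro sum_mono)
    fix l assume "l \<in> {..<length Ks}"
    then have "Ks ! l \<in> set Ks" by simp
    \<comment> \<open>An outcome of probability zero comes with no induction hypothesis, but there
      both sides carry the factor 0.\<close>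
    then show "(vnorm N (?v l))\<^sup>2 * ent_entropy N A \<phi> \<le> (vnorm N (?v l))\<^sup>2 * ent_entropy N A (normalize_vec N (?v l))"
      using locc_step vnorm_normalize_vec[of N "?v l"]
      by (cases "vnorm N (?v l) = 0") (auto intro!: mult_left_mono)
  qed
  also have "\<dots> \<le> ent_entropy N A \<psi>"
    using locc_step by (intro ent_entropy_local_instrument) auto
  finally show ?case .
qed

section \<open>Ancillary qubits\<close>

lemma pull_bij:
  assumes \<sigma>: "inj_on \<sigma> {0..<n}"
  shows "bij_betw (\<lambda>x k. k < n \<and> x (\<sigma> k)) {x \<in> cfgs_on A. \<forall>q. x q \<longrightarrow> q \<in> \<sigma> ` {0..<n}}
    (cfgs_on {k. k < n \<and> \<sigma> k \<in> A})"
proof (rule bij_betw_byWitness[where f' = "\<lambda>y q. \<exists>k<n. q = \<sigma> k \<and> y k"])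
  show "\<forall>a\<in>{x \<in> cfgs_on A. \<forall>q. x q \<longrightarrow> q \<in> \<sigma> ` {0..<n}}. (\<lambda>q. \<exists>k<n. q = \<sigma> k \<and> k < n \<and> a (\<sigma> k)) = a"
  proof (intro ballI ext)
    fix a q assume a: "a \<in> {x \<in> cfgs_on A. \<forall>q. x q \<longrightarrow> q \<in> \<sigma> ` {0..<n}}"
    have "\<exists>k<n. q = \<sigma> k" if "a q"
      using a that by (metis (mono_tags, lifting) atLeastLessThan_iff imageE mem_Collect_eq)
    then show "(\<exists>k<n. q = \<sigma> k \<and> k < n \<and> a (\<sigma> k)) = a q" by blast
  qed
  show "\<forall>a\<in>cfgs_on {k. k < n \<and> \<sigma> k \<in> A}. (\<lambda>k. k < n \<and> (\<exists>ka<n. \<sigma> k = \<sigma> ka \<and> a ka)) = a"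
  proof (intro ballI ext)
    fix a k assume a: "a \<in> cfgs_on {k. k < n \<and> \<sigma> k \<in> A}"
    have "(\<exists>ka<n. \<sigma> k = \<sigma> ka \<and> a ka) \<longleftrightarrow> a k" if "k < n"
      using that \<sigma> by (metis atLeastLessThan_iff inj_onD zero_le)
    moreover have "k < n" if "a k" using a that by (simp add: cfgs_on_def)
    ultimately show "(k < n \<and> (\<exists>ka<n. \<sigma> k = \<sigma> ka \<and> a ka)) = a k" by blast
  qed
qed (auto simp: fun_eq_iff cfgs_on_def)

text \<open>An amplitude vanishes as soon as a bit outside the image of \<open>\<sigma>\<close> is
  set. The reduced density matrix is therefore that of \<open>\<phi>\<close>, relabelled and padded
  with zeros.\<close>

lemma ent_entropy_embed_state:
  assumes \<sigma>: "inj_on \<sigma> {0..<n}" "\<sigma> ` {0..<n} \<subseteq> {0..<N}" and A: "A \<subseteq> {0..<N}"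
  shows "ent_entropy N A (embed_state n \<sigma> \<phi>) = ent_entropy n {k. k < n \<and> \<sigma> k \<in> A} \<phi>"
proof -
  define A' where "A' = {k. k < n \<and> \<sigma> k \<in> A}"
  define B where "B = {0..<N} - A"
  define B' where "B' = {0..<n} - A'"
  define ok where "ok x \<longleftrightarrow> (\<forall>q. x q \<longrightarrow> q \<in> \<sigma> ` {0..<n})" for x :: cfg
  define pull where "pull x = (\<lambda>k. k < n \<and> x (\<sigma> k))" for x :: cfg
  have B': "B' = {k. k < n \<and> \<sigma> k \<in> B}" using \<sigma>(2) by (auto simp: A'_def B'_def B_def)
  have fin: "finite A" "finite A'" "finite B" using A finite_subset by (auto simp: A'_def B_def)
  have pA: "bij_betw pull {x \<in> cfgs_on A. ok x} (cfgs_on A')"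
    using pull_bij[OF \<sigma>(1), of A] unfolding ok_def pull_def A'_def .
  have pB: "bij_betw pull {x \<in> cfgs_on B. ok x} (cfgs_on B')"
    using pull_bij[OF \<sigma>(1), of B] unfolding ok_def pull_def B' .
  define S where "S = {j. j < 2 ^ card A \<and> ok (cfg_of A j)}"
  \<comment> \<open>Sends the row index of a configuration supported on the image of
    \<open>\<sigma>\<close> to the row index of its pullback to the qubits of
    \<open>\<phi>\<close>.\<close>
  define \<iota> where "\<iota> = the_inv_into {..<2 ^ card A'} (cfg_of A') \<circ> (pull \<circ> cfg_of A)"
  have "bij_betw (cfg_of A) S {x \<in> cfgs_on A. ok x}"
    using cfg_of_bij[OF fin(1)] by (auto simp: bij_betw_def S_def inj_on_def)
  then have "bij_betw (pull \<circ> cfg_of A) S (cfgs_on A')" using pA by (rule bij_betw_trans)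
  moreover have c': "bij_betw (the_inv_into {..<2 ^ card A'} (cfg_of A')) (cfgs_on A') {..<2 ^ card A'}"
    by (rule bij_betw_the_inv_into[OF cfg_of_bij[OF fin(2)]])
  ultimately have bij: "bij_betw \<iota> S {..<2 ^ card A'}" unfolding \<iota>_def by (rule bij_betw_trans)
  have cfg\<iota>: "cfg_of A' (\<iota> j) = pull (cfg_of A j)" if "j \<in> S" for j
  proof -
    have "pull (cfg_of A j) \<in> cfgs_on A'"
      using \<open>bij_betw (pull \<circ> cfg_of A) S (cfgs_on A')\<close> that by (auto simp: bij_betw_def)
    then show ?thesis unfolding \<iota>_def using cfg_of_bij[OF fin(2)]
      by (auto simp: bij_betw_def f_the_inv_into_f)
  qed
  have emb: "embed_state n \<sigma> \<phi> (glue A x z) = (if ok x \<and> ok z then \<phi> (glue A' (pull x) (pull z)) else 0)"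
    if "x \<in> cfgs_on A" "z \<in> cfgs_on B" for x z
  proof -
    have "ok (glue A x z) \<longleftrightarrow> ok x \<and> ok z"
      using that by (auto simp: ok_def glue_def cfgs_on_def B_def)
    moreover have "(\<lambda>k. k < n \<and> glue A x z (\<sigma> k)) = glue A' (pull x) (pull z)"
      by (auto simp: glue_def A'_def pull_def fun_eq_iff)
    ultimately show ?thesis unfolding embed_state_def ok_def[symmetric] by simp
  qed
  have "vn_entropy (reduced_dm N A (embed_state n \<sigma> \<phi>)) = vn_entropy (reduced_dm n A' \<phi>)"
  proof (rule vn_entropy_reindex[OF reduced_dm_carrier reduced_dm_carrier _ bij])
    fix j k :: nat assume jk: "j < 2 ^ card A" "k < 2 ^ card A"
    let ?x = "cfg_of A j" and ?y = "cfg_of A k"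
    have xy: "?x \<in> cfgs_on A" "?y \<in> cfgs_on A"
      using jk cfg_of_bij[OF fin(1)] by (auto simp: bij_betw_def)
    have "reduced_dm N A (embed_state n \<sigma> \<phi>) $$ (j, k) = (\<Sum>z\<in>cfgs_on B.
        embed_state n \<sigma> \<phi> (glue A ?x z) * cnj (embed_state n \<sigma> \<phi> (glue A ?y z)))"
      using jk by (simp add: reduced_dm_def B_def)
    also have "\<dots> = (\<Sum>z\<in>{z \<in> cfgs_on B. ok z}. if ok ?x \<and> ok ?y then
        \<phi> (glue A' (pull ?x) (pull z)) * cnj (\<phi> (glue A' (pull ?y) (pull z))) else 0)"
      using fin xy by (intro sum.mono_neutral_cong_right) (auto simp: emb)
    also have "\<dots> = (\<Sum>z\<in>cfgs_on B'. if ok ?x \<and> ok ?y then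
        \<phi> (glue A' (pull ?x) z) * cnj (\<phi> (glue A' (pull ?y) z)) else 0)"
      by (rule sum.reindex_bij_betw[OF pB])
    also have "\<dots> = (if j \<in> S \<and> k \<in> S then reduced_dm n A' \<phi> $$ (\<iota> j, \<iota> k) else 0)"
    proof (cases "j \<in> S \<and> k \<in> S")
      case True
      then have "\<iota> j < 2 ^ card A'" "\<iota> k < 2 ^ card A'" using bij by (auto simp: bij_betw_def)
      then show ?thesis using True by (simp add: reduced_dm_def cfg\<iota> B'_def) (simp add: S_def)
    next
      case False
      then show ?thesis using jk by (auto simp: S_def)
    qed
    finally show "reduced_dm N A (embed_state n \<sigma> \<phi>) $$ (j, k) =
        (if j \<in> S \<and> k \<in> S then reduced_dm n A' \<phi> $$ (\<iota> j, \<iota> k) else 0)" .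
  qed (auto simp: S_def)
  then show ?thesis by (simp add: ent_entropy_def A'_def)
qed

section \<open>Restricting subcubic trees\<close>

text \<open>An edge may be sent to a walk or collapsed to a point, as contraction and subdivision of
  trees require.\<close>

lemma rtrancl_hom:
  assumes "(x, y) \<in> R\<^sup>*" "\<And>u v. (u, v) \<in> R \<Longrightarrow> (f u, f v) \<in> S\<^sup>*"
  shows "(f x, f y) \<in> S\<^sup>*"
  using assms(1) by (induction rule: rtrancl_induct) (auto intro: rtrancl_trans assms(2))

lemma adj_rtrancl_sym: "(x, y) \<in> (adj E)\<^sup>* \<Longrightarrow> (y, x) \<in> (adj E)\<^sup>*"
  by (rule symD[OF sym_rtrancl]) (auto simp: sym_def adj_def insert_commute)

text \<open>Every vertex of \<open>V\<close> other than \<open>r\<close> has a neighbour strictly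
  closer to \<open>r\<close>. The edge to it determines the vertex: if two distinct vertices shared
  that edge, each would be closer to \<open>r\<close> than the other.\<close>

lemma connected_card_le:
  assumes fin: "finite E" and r: "r \<in> V" and conn: "\<And>v. v \<in> V \<Longrightarrow> (r, v) \<in> (adj E)\<^sup>*"
  shows "card V \<le> card E + 1"
proof -
  define d where "d v = (LEAST n. (r, v) \<in> adj E ^^ n)" for v
  have "\<exists>u. (u, v) \<in> adj E \<and> d u < d v" if v: "v \<in> V - {r}" for v
  proof -
    obtain n where n: "(r, v) \<in> adj E ^^ n" using conn[of v] v by (meson DiffD1 rtrancl_imp_relpow)
    have dv: "(r, v) \<in> adj E ^^ d v" unfolding d_def by (rule LeastI[where P = "\<lambda>n. (r, v) \<in> adj E ^^ n", OF n])
    with v obtain m where m: "d v = Suc m" by (cases "d v") auto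
    with dv obtain u where u: "(r, u) \<in> adj E ^^ m" "(u, v) \<in> adj E" by auto
    have "d u \<le> m" unfolding d_def by (rule Least_le[where P = "\<lambda>n. (r, u) \<in> adj E ^^ n", OF u(1)])
    with u(2) m show ?thesis by (intro exI[of _ u]) simp
  qed
  then obtain p where p: "\<And>v. v \<in> V - {r} \<Longrightarrow> (p v, v) \<in> adj E" "\<And>v. v \<in> V - {r} \<Longrightarrow> d (p v) < d v"
    by metis
  have "inj_on (\<lambda>v. {p v, v}) (V - {r})"
  proof (rule inj_onI)
    fix v w assume vw: "v \<in> V - {r}" "w \<in> V - {r}" "{p v, v} = {p w, w}"
    show "v = w"
    proof (rule ccontr)
      assume "v \<noteq> w"
      then have "v = p w" "w = p v" using vw(3) by (auto simp: doubleton_eq_iff)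
      then show False using p(2)[OF vw(1)] p(2)[OF vw(2)] by simp
    qed
  qed
  moreover have "(\<lambda>v. {p v, v}) ` (V - {r}) \<subseteq> E" using p(1) by (auto simp: adj_def)
  ultimately have "card (V - {r}) \<le> card E" using fin by (metis card_image card_mono)
  then show ?thesis using r by (cases "finite V") auto
qed

section \<open>Removing leaves\<close>

definition leaf_vertices :: "nat set \<Rightarrow> nat set \<Rightarrow> vtx set" where
  "leaf_vertices L I = Inl ` L \<union> Inr ` I"

text \<open>The leaf set is arbitrary because removing a leaf leaves a gap in the numbering of the
  qubits.\<close>

definition leaf_tree :: "nat set \<Rightarrow> nat set \<Rightarrow> vtx set set \<Rightarrow> bool" where
  "leaf_tree L I Et \<longleftrightarrow> finite L \<and> finite I \<and>
     (\<forall>e\<in>Et. card e = 2 \<and> e \<subseteq> leaf_vertices L I) \<and>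
     (\<forall>u\<in>leaf_vertices L I. \<forall>v\<in>leaf_vertices L I. (u, v) \<in> (adj Et)\<^sup>*) \<and>
     card Et + 1 = card (leaf_vertices L I) \<and>
     (\<forall>q\<in>L. Defs.degree Et (Inl q) = 1) \<and> (\<forall>k\<in>I. Defs.degree Et (Inr k) = 3)"

lemma subcubic_tree_iff: "subcubic_tree N I Et \<longleftrightarrow> leaf_tree {0..<N} I Et"
  by (auto simp: subcubic_tree_def leaf_tree_def tree_vertices_def leaf_vertices_def)

lemma leaf_treeD:
  assumes "leaf_tree L I Et"
  shows "finite L" "finite I" "\<And>e. e \<in> Et \<Longrightarrow> card e = 2" "\<And>e. e \<in> Et \<Longrightarrow> e \<subseteq> leaf_vertices L I"
    "\<And>u v. u \<in> leaf_vertices L I \<Longrightarrow> v \<in> leaf_vertices L I \<Longrightarrow> (u, v) \<in> (adj Et)\<^sup>*"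
    "card Et + 1 = card (leaf_vertices L I)" "finite (leaf_vertices L I)" "finite Et"
    "\<And>q. q \<in> L \<Longrightarrow> Defs.degree Et (Inl q) = 1" "\<And>k. k \<in> I \<Longrightarrow> Defs.degree Et (Inr k) = 3"
proof -
  show fin: "finite (leaf_vertices L I)" using assms by (simp add: leaf_tree_def leaf_vertices_def)
  have "Et \<subseteq> Pow (leaf_vertices L I)" using assms by (auto simp: leaf_tree_def)
  then show "finite Et" by (rule finite_subset) (simp add: fin)
qed (use assms in \<open>auto simp: leaf_tree_def\<close>)

lemma card_2_memE:
  assumes "card e = 2" "u \<in> e"
  obtains v where "e = {u, v}" "u \<noteq> v"
  using assms by (auto simp: card_2_iff)

lemma card_insert_remove:
  "finite S \<Longrightarrow> y \<in> S \<Longrightarrow> x \<notin> S \<Longrightarrow> card (insert x (S - {y})) = card S"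
  by (metis Diff_iff card.insert_remove card_Suc_Diff1 finite_Diff card_insert_disjoint)

text \<open>The relation of staying connected records a split without singling out a side. Only one
  direction is demanded: each split of \<open>Et'\<close> comes from an edge of
  \<open>Et\<close>.\<close>

definition same_splits :: "nat set \<Rightarrow> vtx set set \<Rightarrow> vtx set set \<Rightarrow> bool" where
  "same_splits L Et' Et \<longleftrightarrow> (\<forall>e'\<in>Et'. \<exists>e\<in>Et. \<forall>x\<in>L. \<forall>y\<in>L.
     (Inl x, Inl y) \<in> (adj (Et' - {e'}))\<^sup>* \<longleftrightarrow> (Inl x, Inl y) \<in> (adj (Et - {e}))\<^sup>*)"

text \<open>If the neighbour of \<open>q\<close> were also a leaf, the two would spend their only
  edge on each other and form a component of their own, out of reach of a third leaf. So the
  neighbour is an inner vertex of degree 3.\<close>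

lemma leaf_neighbours:
  assumes T: "leaf_tree L I Et" and q: "q \<in> L" and L: "3 \<le> card L"
  obtains k a b where "k \<in> I" "{Inl q, Inr k} \<in> Et" "{a, Inr k} \<in> Et" "{b, Inr k} \<in> Et"
    "a \<noteq> b" "a \<noteq> Inl q" "b \<noteq> Inl q" "a \<noteq> Inr k" "b \<noteq> Inr k"
    "\<And>e. e \<in> Et \<Longrightarrow> Inl q \<in> e \<Longrightarrow> e = {Inl q, Inr k}"
    "\<And>e. e \<in> Et \<Longrightarrow> Inr k \<in> e \<Longrightarrow> e = {Inl q, Inr k} \<or> e = {a, Inr k} \<or> e = {b, Inr k}"
proof -
  note D = leaf_treeD[OF T]
  obtain e0 where e0: "{e \<in> Et. Inl q \<in> e} = {e0}"
    using D(9)[OF q] unfolding degree_def by (auto simp: card_1_singleton_iff)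
  then have e0': "e0 \<in> Et" "Inl q \<in> e0" by auto
  obtain w where w: "e0 = {Inl q, w}" "Inl q \<noteq> w" using card_2_memE[OF D(3)[OF e0'(1)] e0'(2)] .
  have wV: "w \<in> leaf_vertices L I" using D(4)[OF e0'(1)] w by auto
  have "w \<notin> Inl ` L"
  proof
    assume "w \<in> Inl ` L"
    then obtain p where p: "w = Inl p" "p \<in> L" by auto
    obtain e1 where "{e \<in> Et. w \<in> e} = {e1}"
      using D(9)[OF p(2)] p(1) unfolding degree_def by (auto simp: card_1_singleton_iff)
    moreover have "e0 \<in> {e \<in> Et. w \<in> e}" using e0' w by auto
    ultimately have ew: "{e \<in> Et. w \<in> e} = {e0}" by auto
    have "\<not> L \<subseteq> {q, p}"
    proof
      assume "L \<subseteq> {q, p}"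
      then have "card L \<le> card {q, p}" by (intro card_mono) auto
      also have "\<dots> \<le> 2" by (simp add: card_insert_if)
      finally show False using L by simp
    qed
    then obtain r where r: "r \<in> L" "r \<noteq> q" "r \<noteq> p" by auto
    have "y \<in> {Inl q, w}" if "(Inl q, y) \<in> (adj Et)\<^sup>*" for y
      using that
    proof (induction rule: rtrancl_induct)
      case (step y z)
      then have "{y, z} \<in> Et" by (simp add: adj_def)
      moreover have "d = e0" if "d \<in> Et" "Inl q \<in> d \<or> w \<in> d" for d
        using that e0 ew by auto
      ultimately have "{y, z} = e0" using step.IH by (metis insert_iff singletonD)
      then show ?case using w by (auto simp: doubleton_eq_iff)
    qed simp
    moreover have "(Inl q, Inl r) \<in> (adj Et)\<^sup>*" using q r(1) by (intro D(5)) (auto simp: leaf_vertices_def)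
    ultimately have "Inl r \<in> {Inl q, w}" by blast
    then show False using r p by auto
  qed
  then obtain k where k: "w = Inr k" "k \<in> I" using wV by (auto simp: leaf_vertices_def)
  let ?F = "{e \<in> Et. w \<in> e}"
  have F: "card ?F = 3" using D(10)[OF k(2)] k(1) by (simp add: degree_def)
  have e0F: "e0 \<in> ?F" using e0' w by auto
  have "card (?F - {e0}) = 2" using F e0F D(8) by (simp add: card_Diff_singleton)
  then obtain e1 e2 where e12: "?F - {e0} = {e1, e2}" "e1 \<noteq> e2" by (auto simp: card_2_iff)
  have e1: "e1 \<in> Et" "w \<in> e1" "e1 \<noteq> e0" and e2: "e2 \<in> Et" "w \<in> e2" "e2 \<noteq> e0" using e12 by auto
  obtain a where a: "e1 = {w, a}" "w \<noteq> a" using card_2_memE[OF D(3)[OF e1(1)] e1(2)] .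
  obtain b where b: "e2 = {w, b}" "w \<noteq> b" using card_2_memE[OF D(3)[OF e2(1)] e2(2)] .
  show thesis
  proof (rule that[of k a b])
    show "e = {Inl q, Inr k} \<or> e = {a, Inr k} \<or> e = {b, Inr k}" if "e \<in> Et" "Inr k \<in> e" for e
    proof -
      have "e \<in> ?F" using that k(1) by auto
      then have "e = e0 \<or> e = e1 \<or> e = e2" using e12(1) by blast
      then show ?thesis using w(1) a(1) b(1) k(1) by (metis insert_commute)
    qed
    show "e = {Inl q, Inr k}" if "e \<in> Et" "Inl q \<in> e" for e
      using that e0 w k by auto
  qed (use k e0' e1 e2 e12 w a b in \<open>auto simp: insert_commute\<close>)
qed

lemma leaf_tree_prune:
  assumes T: "leaf_tree L I Et" and q: "q \<in> L" and L: "3 \<le> card L"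
  obtains I' Et' where "leaf_tree (L - {q}) I' Et'" "same_splits (L - {q}) Et' Et"
proof -
  note D = leaf_treeD[OF T]
  obtain k a b where k: "k \<in> I" and in_Et: "{Inl q, Inr k} \<in> Et" "{a, Inr k} \<in> Et" "{b, Inr k} \<in> Et"
    and ne: "a \<noteq> b" "a \<noteq> Inl q" "b \<noteq> Inl q" "a \<noteq> Inr k" "b \<noteq> Inr k"
    and atq: "\<And>e. e \<in> Et \<Longrightarrow> Inl q \<in> e \<Longrightarrow> e = {Inl q, Inr k}"
    and atw: "\<And>e. e \<in> Et \<Longrightarrow> Inr k \<in> e \<Longrightarrow> e = {Inl q, Inr k} \<or> e = {a, Inr k} \<or> e = {b, Inr k}"
  proof (rule leaf_neighbours[OF T q L], goal_cases)
    case (1 k a b)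
    show ?case by (rule that[of k a b]; fact 1)
  qed
  define V where "V = leaf_vertices L I"
  define V' where "V' = leaf_vertices (L - {q}) (I - {k})"
  define Q :: vtx where "Q = Inl q"
  define w :: vtx where "w = Inr k"
  define e0 where "e0 = {Q, w}"
  define e1 where "e1 = {a, w}"
  define e2 where "e2 = {b, w}"
  define Eo where "Eo = Et - {e0, e1, e2}"
  define E' where "E' = insert {a, b} Eo"
  have Et: "e0 \<in> Et" "e1 \<in> Et" "e2 \<in> Et" using in_Et by (auto simp: e0_def e1_def e2_def Q_def w_def)
  have Qw: "Q \<noteq> w" "a \<noteq> Q" "b \<noteq> Q" "a \<noteq> w" "b \<noteq> w" using ne by (auto simp: Q_def w_def)
  have dist: "e0 \<noteq> e1" "e0 \<noteq> e2" "e1 \<noteq> e2"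
    using ne Qw by (auto simp: e0_def e1_def e2_def doubleton_eq_iff)
  have Eo_avoid: "Q \<notin> e" "w \<notin> e" if "e \<in> Eo" for e
    using that atq atw by (auto simp: Eo_def e0_def e1_def e2_def Q_def w_def)
  have V': "V' = V - {Q, w}"
    by (auto simp: V'_def V_def leaf_vertices_def Q_def w_def)
  have QV: "Q \<in> V" "w \<in> V" using q k by (auto simp: V_def leaf_vertices_def Q_def w_def)
  have abV': "a \<in> V'" "b \<in> V'" using D(4)[OF Et(2)] D(4)[OF Et(3)] Qw by (auto simp: V' V_def e1_def e2_def)
  have finV: "finite V" using D(7) by (simp add: V_def)
  have cV': "card V' + 2 = card V"
    using QV Qw(1) finV card_mono[of V "{Q, w}"] by (simp add: V' card_Diff_subset)
  have cEo: "card Eo + 3 = card Et"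
    using Et dist D(8) card_mono[of Et "{e0, e1, e2}"] by (simp add: Eo_def card_Diff_subset)
  have finEo: "finite Eo" using D(8) by (simp add: Eo_def)
  define c where "c v = (if v = Q \<or> v = w then b else v)" for v
  have cV: "c v = v" if "v \<in> V'" for v using that by (auto simp: c_def V')
  txt \<open>Contracting the removed leaf and its neighbour onto \<open>b\<close> turns walks of the old tree into
    walks of the new one, whichever edges have been deleted.\<close>
  have hom: "(c u, c v) \<in> (adj ((F \<inter> Eo) \<union> (if e1 \<in> F then {{a, b}} else {})))\<^sup>*"
    if F: "F \<subseteq> Et" and uv: "(u, v) \<in> adj F" for F u v
  proof -
    have uvF: "{u, v} \<in> F" using uv by (simp add: adj_def)
    then consider "{u, v} \<in> Eo" | "{u, v} = e0" | "{u, v} = e1" | "{u, v} = e2"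
      using F by (auto simp: Eo_def)
    then show ?thesis
    proof cases
      case 1
      then have "c u = u" "c v = v" using Eo_avoid[OF 1] by (auto simp: c_def)
      then show ?thesis using uvF 1 by (intro r_into_rtrancl) (auto simp: adj_def)
    next
      case 2
      then have "c u = b" "c v = b" by (auto simp: e0_def c_def doubleton_eq_iff)
      then show ?thesis by simp
    next
      case 3
      then have "{c u, c v} = {a, b}" using Qw by (auto simp: e1_def c_def doubleton_eq_iff)
      then show ?thesis using uvF 3 by (intro r_into_rtrancl) (auto simp: adj_def)
    next
      case 4
      then have "c u = b" "c v = b" using Qw by (auto simp: e2_def c_def doubleton_eq_iff)
      then show ?thesis by simp
    qed
  qed
  have conn: "(u, v) \<in> (adj E')\<^sup>*" if uv: "u \<in> V'" "v \<in> V'" for u v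
  proof -
    have "(u, v) \<in> (adj Et)\<^sup>*" using D(5) uv by (auto simp: V' V_def)
    then have "(c u, c v) \<in> (adj ((Et \<inter> Eo) \<union> (if e1 \<in> Et then {{a, b}} else {})))\<^sup>*"
      by (rule rtrancl_hom) (rule hom[OF subset_refl])
    moreover have "(Et \<inter> Eo) \<union> (if e1 \<in> Et then {{a, b}} else {}) = E'"
      using Et by (auto simp: E'_def Eo_def)
    ultimately show ?thesis using uv by (simp add: cV)
  qed
  \<comment> \<open>If this edge were already present, the \<open>card Et - 3\<close> remaining
    edges would connect all \<open>card V - 2\<close> remaining vertices, one edge too few for
    connectedness.\<close>
  have ab: "{a, b} \<notin> Et"
  proof
    assume "{a, b} \<in> Et"
    then have "{a, b} \<in> Eo" using Qw by (auto simp: Eo_def e0_def e1_def e2_def doubleton_eq_iff)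
    then have "E' = Eo" by (auto simp: E'_def)
    then have "card V' \<le> card Eo + 1"
      using connected_card_le[of E' a V'] finEo abV' conn by auto
    then show False using cV' cEo D(6) by (simp add: V_def)
  qed
  have abEo: "{a, b} \<notin> Eo" using ab by (simp add: Eo_def)
  have cE': "card E' + 2 = card Et" using abEo finEo cEo by (simp add: E'_def)
  \<comment> \<open>At \<open>a\<close> the new edge replaces \<open>e1\<close>, at \<open>b\<close>
    it replaces \<open>e2\<close>; all other remaining vertices keep their edges.\<close>
  have deg: "Defs.degree E' v = Defs.degree Et v" if v: "v \<in> V'" for v
  proof -
    have vQ: "v \<noteq> Q" "v \<noteq> w" using v by (auto simp: V')
    have fin: "finite {e \<in> Et. v \<in> e}" using D(8) by simp
    consider "v = a" | "v = b" | "v \<noteq> a" "v \<noteq> b" by blast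
    then show ?thesis
    proof cases
      case 1
      have "{e \<in> E'. v \<in> e} = insert {a, b} ({e \<in> Et. v \<in> e} - {e1})"
        using 1 vQ ne(1) Qw by (auto simp: E'_def Eo_def e0_def e2_def)
      moreover have "card (insert {a, b} ({e \<in> Et. v \<in> e} - {e1})) = card {e \<in> Et. v \<in> e}"
        using fin Et ab 1 by (intro card_insert_remove) (auto simp: e1_def)
      ultimately show ?thesis by (simp add: degree_def)
    next
      case 2
      have "{e \<in> E'. v \<in> e} = insert {a, b} ({e \<in> Et. v \<in> e} - {e2})"
        using 2 vQ ne(1) Qw by (auto simp: E'_def Eo_def e0_def e1_def)
      moreover have "card (insert {a, b} ({e \<in> Et. v \<in> e} - {e2})) = card {e \<in> Et. v \<in> e}"
        using fin Et ab 2 by (intro card_insert_remove) (auto simp: e2_def)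
      ultimately show ?thesis by (simp add: degree_def)
    next
      case 3
      then have "{e \<in> E'. v \<in> e} = {e \<in> Et. v \<in> e}"
        using vQ by (auto simp: E'_def Eo_def e0_def e1_def e2_def)
      then show ?thesis by (simp add: degree_def)
    qed
  qed
  have "leaf_tree (L - {q}) (I - {k}) E'"
    unfolding leaf_tree_def V'_def[symmetric]
  proof (intro conjI ballI)
    show "card e = 2" if "e \<in> E'" for e using that ne(1) D(3) by (auto simp: E'_def Eo_def)
    show "e \<subseteq> V'" if "e \<in> E'" for e
    proof (cases "e = {a, b}")
      case False
      then have e: "e \<in> Eo" using that by (simp add: E'_def)
      then have "e \<subseteq> V" using D(4) by (auto simp: Eo_def V_def)
      then show ?thesis using Eo_avoid[OF e] by (auto simp: V')
    qed (use abV' in auto)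
    show "card E' + 1 = card V'" using cE' cV' D(6) by (simp add: V_def)
    show "Defs.degree E' (Inl p) = 1" if "p \<in> L - {q}" for p
      using that deg[of "Inl p"] D(9)[of p] by (auto simp: V'_def leaf_vertices_def)
    show "Defs.degree E' (Inr p) = 3" if "p \<in> I - {k}" for p
      using that deg[of "Inr p"] D(10)[of p] by (auto simp: V'_def leaf_vertices_def)
  qed (use D conn in auto)
  moreover have "same_splits (L - {q}) E' Et"
    unfolding same_splits_def
  proof (intro ballI)
    fix e' assume e': "e' \<in> E'"
    \<comment> \<open>The contraction \<open>c\<close> carries \<open>e1\<close> to the new edge and
      collapses \<open>e0\<close> and \<open>e2\<close>, so deleting \<open>{a, b}\<close>
      corresponds to deleting \<open>e1\<close>.\<close>
    define e where "e = (if e' = {a, b} then e1 else e')"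
    have eEt: "e \<in> Et" using e' Et by (auto simp: e_def E'_def Eo_def)
    have image: "((Et - {e}) \<inter> Eo) \<union> (if e1 \<in> Et - {e} then {{a, b}} else {}) = E' - {e'}"
      using e' Et abEo by (auto simp: e_def E'_def Eo_def)
    have step: "(u, v) \<in> (adj (Et - {e}))\<^sup>*" if uv: "(u, v) \<in> adj (E' - {e'})" for u v
    proof (cases "{u, v} = {a, b}")
      case True
      \<comment> \<open>As long as the new edge is present, \<open>e1\<close> and \<open>e2\<close>
        both survive in the old tree and join \<open>a\<close> to \<open>b\<close> through
        \<open>w\<close>.\<close>
      then have "e = e'" "e' \<in> Eo" using uv e' by (auto simp: e_def adj_def E'_def)
      then have "e1 \<noteq> e" "e2 \<noteq> e" by (auto simp: Eo_def)
      then have "(a, w) \<in> adj (Et - {e})" "(w, b) \<in> adj (Et - {e})"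
        using Et by (auto simp: adj_def e1_def e2_def insert_commute)
      then have "(a, b) \<in> (adj (Et - {e}))\<^sup>*" by (meson converse_rtrancl_into_rtrancl r_into_rtrancl)
      then show ?thesis using True adj_rtrancl_sym by (auto simp: doubleton_eq_iff)
    next
      case False
      then have "{u, v} \<in> Eo" "{u, v} \<noteq> e'" using uv by (auto simp: adj_def E'_def)
      then have "(u, v) \<in> adj (Et - {e})" by (auto simp: adj_def Eo_def e_def)
      then show ?thesis by blast
    qed
    have "(Inl x, Inl y) \<in> (adj (E' - {e'}))\<^sup>* \<longleftrightarrow> (Inl x, Inl y) \<in> (adj (Et - {e}))\<^sup>*"
      if xy: "x \<in> L - {q}" "y \<in> L - {q}" for x y
    proof
      assume "(Inl x, Inl y) \<in> (adj (E' - {e'}))\<^sup>*"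
      then show "(Inl x, Inl y) \<in> (adj (Et - {e}))\<^sup>*"
        by (rule rtrancl_hom[where f = "\<lambda>v. v"]) (rule step)
    next
      assume "(Inl x, Inl y) \<in> (adj (Et - {e}))\<^sup>*"
      then have "(c (Inl x), c (Inl y)) \<in> (adj (E' - {e'}))\<^sup>*"
        using hom[of "Et - {e}"] unfolding image by (rule rtrancl_hom) auto
      then show "(Inl x, Inl y) \<in> (adj (E' - {e'}))\<^sup>*"
        using xy cV by (auto simp: V'_def leaf_vertices_def)
    qed
    then show "\<exists>e\<in>Et. \<forall>x\<in>L - {q}. \<forall>y\<in>L - {q}.
        (Inl x, Inl y) \<in> (adj (E' - {e'}))\<^sup>* \<longleftrightarrow> (Inl x, Inl y) \<in> (adj (Et - {e}))\<^sup>*"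
      using eEt by blast
  qed
  ultimately show thesis using that by blast
qed

lemma same_splits_refl: "same_splits L Et Et"
  by (auto simp: same_splits_def)

lemma same_splits_trans:
  assumes "same_splits L E1 E2" "same_splits L' E2 E3" "L \<subseteq> L'"
  shows "same_splits L E1 E3"
  unfolding same_splits_def
proof
  fix e1 assume "e1 \<in> E1"
  then obtain e2 where e2: "e2 \<in> E2" "\<forall>x\<in>L. \<forall>y\<in>L.
     (Inl x, Inl y) \<in> (adj (E1 - {e1}))\<^sup>* \<longleftrightarrow> (Inl x, Inl y) \<in> (adj (E2 - {e2}))\<^sup>*"
    using assms(1) unfolding same_splits_def by blast
  then obtain e3 where e3: "e3 \<in> E3" "\<forall>x\<in>L'. \<forall>y\<in>L'.
     (Inl x, Inl y) \<in> (adj (E2 - {e2}))\<^sup>* \<longleftrightarrow> (Inl x, Inl y) \<in> (adj (E3 - {e3}))\<^sup>*"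
    using assms(2) unfolding same_splits_def by blast
  show "\<exists>e\<in>E3. \<forall>x\<in>L. \<forall>y\<in>L. (Inl x, Inl y) \<in> (adj (E1 - {e1}))\<^sup>* \<longleftrightarrow> (Inl x, Inl y) \<in> (adj (E3 - {e}))\<^sup>*"
    using e2(2) e3 assms(3) by (intro bexI[of _ e3]) (auto simp: subset_iff)
qed

lemma leaf_tree_restrict:
  assumes "finite D" "leaf_tree (L \<union> D) I Et" "L \<inter> D = {}" "2 \<le> card L"
  shows "\<exists>I' Et'. leaf_tree L I' Et' \<and> same_splits L Et' Et"
  using assms
proof (induction D arbitrary: I Et rule: finite_induct)
  case empty
  then show ?case using same_splits_refl by auto
next
  case (insert q D)
  have finL: "finite L" using insert.prems(3) card.infinite by fastforce
  have q: "q \<notin> L" "q \<notin> D" using insert by auto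
  \<comment> \<open>Two leaves are kept throughout, so together with \<open>q\<close> there are at
    least three at each deletion, as pruning requires.\<close>
  have "card (insert q L) \<le> card (L \<union> insert q D)"
    using finL insert.hyps(1) by (intro card_mono) auto
  then have "3 \<le> card (L \<union> insert q D)" using q finL insert.prems(3) by simp
  then obtain I1 E1 where T1: "leaf_tree (L \<union> insert q D - {q}) I1 E1"
    "same_splits (L \<union> insert q D - {q}) E1 Et"
    using leaf_tree_prune[OF insert.prems(1), of q] by blast
  have eq: "L \<union> insert q D - {q} = L \<union> D" using q by auto
  obtain I' Et' where "leaf_tree L I' Et'" "same_splits L Et' E1"
    using insert.IH[OF T1(1)[unfolded eq]] insert.prems by auto
  then show ?case using same_splits_trans[OF _ T1(2)[unfolded eq]] by blast
qed

section \<open>Relabelled leaves and edge splits\<close>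

text \<open>Restriction retains the qubit numbers of the larger system, while a tree for the target
  must number its leaves from 0; inner labels stay as they are.\<close>

lemma leaf_tree_relabel:
  assumes T: "leaf_tree L I Et" and \<tau>: "inj_on \<tau> L"
  obtains E2 where "leaf_tree (\<tau> ` L) I E2"
    "\<And>e2. e2 \<in> E2 \<Longrightarrow> \<exists>e\<in>Et. \<forall>x\<in>L. \<forall>y\<in>L.
      (Inl (\<tau> x), Inl (\<tau> y)) \<in> (adj (E2 - {e2}))\<^sup>* \<longleftrightarrow> (Inl x, Inl y) \<in> (adj (Et - {e}))\<^sup>*"
proof -
  note D = leaf_treeD[OF T]
  define V where "V = leaf_vertices L I"
  define f :: "vtx \<Rightarrow> vtx" where "f = map_sum \<tau> id"
  define g where "g = inv_into V f"
  define E2 where "E2 = (`) f ` Et"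
  have f: "f (Inl x) = Inl (\<tau> x)" "f (Inr k) = Inr k" for x k by (auto simp: f_def)
  have inj: "inj_on f V"
    by (rule inj_onI) (auto simp: V_def leaf_vertices_def f dest: inj_onD[OF \<tau>])
  have fV: "f ` V = leaf_vertices (\<tau> ` L) I"
    by (simp add: V_def leaf_vertices_def f image_Un image_image)
  have EV: "e \<subseteq> V" if "e \<in> Et" for e using D(4)[OF that] by (simp add: V_def)
  have injE: "inj_on ((`) f) Et"
    by (rule inj_on_subset[OF inj_on_image_Pow[OF inj]]) (use EV in auto)
  have fwd: "(f u, f v) \<in> adj ((`) f ` F)" if "(u, v) \<in> adj F" for F u v
  proof -
    have "f ` {u, v} \<in> (`) f ` F" using that by (intro imageI) (simp add: adj_def)
    then show ?thesis by (simp add: adj_def)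
  qed
  have bwd: "(g u, g v) \<in> adj F" if F: "F \<subseteq> Et" and uv: "(u, v) \<in> adj ((`) f ` F)" for F u v
  proof -
    obtain d where d: "d \<in> F" "{u, v} = f ` d" using uv by (auto simp: adj_def)
    have "{g u, g v} = g ` {u, v}" by simp
    also have "\<dots> = d" unfolding d(2) g_def
      using inv_into_image_cancel[OF inj] EV d(1) F by blast
    finally show ?thesis using d(1) by (simp add: adj_def)
  qed
  have gf: "g (f v) = v" if "v \<in> V" for v using that inj by (simp add: g_def)
  have deg: "Defs.degree E2 (f v) = Defs.degree Et v" if v: "v \<in> V" for v
  proof -
    have "{e \<in> E2. f v \<in> e} = (`) f ` {e \<in> Et. v \<in> e}"
    proof -
      have "f v \<in> f ` e \<longleftrightarrow> v \<in> e" if "e \<in> Et" for e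
        using inj_on_image_mem_iff[OF inj v EV[OF that]] .
      then show ?thesis by (auto simp: E2_def)
    qed
    moreover have "inj_on ((`) f) {e \<in> Et. v \<in> e}" by (rule inj_on_subset[OF injE]) auto
    ultimately show ?thesis by (simp add: degree_def card_image)
  qed
  have "leaf_tree (\<tau> ` L) I E2"
    unfolding leaf_tree_def fV[symmetric]
  proof (intro conjI ballI)
    show "card e = 2" if e: "e \<in> E2" for e
    proof -
      obtain d where d: "d \<in> Et" "e = f ` d" using e by (auto simp: E2_def)
      then show ?thesis using D(3) card_image[OF inj_on_subset[OF inj EV[OF d(1)]]] by simp
    qed
    show "e \<subseteq> f ` V" if "e \<in> E2" for e using that EV by (auto simp: E2_def)
    show "(u, v) \<in> (adj E2)\<^sup>*" if uv: "u \<in> f ` V" "v \<in> f ` V" for u v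
    proof -
      obtain u' v' where u'v': "u = f u'" "v = f v'" "u' \<in> V" "v' \<in> V" using uv by auto
      have "(u', v') \<in> (adj Et)\<^sup>*" using D(5) u'v' by (simp add: V_def)
      then show ?thesis unfolding u'v'(1,2) E2_def
        by (rule rtrancl_hom) (use fwd in blast)
    qed
    show "card E2 + 1 = card (f ` V)"
      using D(6) card_image[OF injE] card_image[OF inj] by (simp add: E2_def V_def)
    show "Defs.degree E2 (Inl q) = 1" if q: "q \<in> \<tau> ` L" for q
    proof -
      obtain p where p: "p \<in> L" "q = \<tau> p" using q by auto
      then show ?thesis using deg[of "Inl p"] D(9)[of p] by (simp add: f V_def leaf_vertices_def)
    qed
    show "Defs.degree E2 (Inr k) = 3" if "k \<in> I" for k
      using that deg[of "Inr k"] D(10)[of k] by (simp add: f V_def leaf_vertices_def)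
  qed (use D in auto)
  moreover have "\<exists>e\<in>Et. \<forall>x\<in>L. \<forall>y\<in>L.
      (Inl (\<tau> x), Inl (\<tau> y)) \<in> (adj (E2 - {e2}))\<^sup>* \<longleftrightarrow> (Inl x, Inl y) \<in> (adj (Et - {e}))\<^sup>*"
    if e2: "e2 \<in> E2" for e2
  proof -
    obtain e where e: "e \<in> Et" "e2 = f ` e" using e2 by (auto simp: E2_def)
    have E2e: "E2 - {e2} = (`) f ` (Et - {e})"
      using inj_on_image_set_diff[OF injE, of Et "{e}"] e by (simp add: E2_def)
    have "(Inl (\<tau> x), Inl (\<tau> y)) \<in> (adj (E2 - {e2}))\<^sup>* \<longleftrightarrow> (Inl x, Inl y) \<in> (adj (Et - {e}))\<^sup>*"
      if xy: "x \<in> L" "y \<in> L" for x y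
    proof
      have V: "Inl x \<in> V" "Inl y \<in> V" using xy by (auto simp: V_def leaf_vertices_def)
      assume "(Inl (\<tau> x), Inl (\<tau> y)) \<in> (adj (E2 - {e2}))\<^sup>*"
      then have "(g (f (Inl x)), g (f (Inl y))) \<in> (adj (Et - {e}))\<^sup>*"
        unfolding E2e f by (rule rtrancl_hom) (use bwd[of "Et - {e}"] in blast)
      then show "(Inl x, Inl y) \<in> (adj (Et - {e}))\<^sup>*" by (simp add: gf V)
    next
      assume "(Inl x, Inl y) \<in> (adj (Et - {e}))\<^sup>*"
      then have "(f (Inl x), f (Inl y)) \<in> (adj (E2 - {e2}))\<^sup>*"
        unfolding E2e by (rule rtrancl_hom) (use fwd in blast)
      then show "(Inl (\<tau> x), Inl (\<tau> y)) \<in> (adj (E2 - {e2}))\<^sup>*" by (simp add: f)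
    qed
    then show ?thesis using e(1) by blast
  qed
  ultimately show thesis using that by blast
qed

text \<open>After deletion of \<open>e\<close> every leaf is reachable from one of its endpoints.
  Two leaves that miss the endpoint chosen by \<open>edge_side\<close> are both reachable from the
  other one, hence connected to each other.\<close>

lemma edge_side_iff:
  assumes T: "subcubic_tree N I Et" and e: "e \<in> Et" and xy: "x < N" "y < N"
  shows "(Inl x, Inl y) \<in> (adj (Et - {e}))\<^sup>* \<longleftrightarrow> (x \<in> edge_side N Et e \<longleftrightarrow> y \<in> edge_side N Et e)"
proof -
  note D = leaf_treeD[OF T[unfolded subcubic_tree_iff]]
  let ?R = "(adj (Et - {e}))\<^sup>*"
  define u where "u = (SOME u. u \<in> e)"
  have "e \<noteq> {}" using D(3)[OF e] by auto
  then have ue: "u \<in> e" unfolding u_def by (simp add: some_in_eq)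
  then obtain v where v: "e = {u, v}" using card_2_memE[OF D(3)[OF e]] by blast
  have uV: "u \<in> leaf_vertices {0..<N} I" using D(4)[OF e] ue by auto
  have cover: "(u, z) \<in> ?R \<or> (v, z) \<in> ?R" if "(u, z) \<in> (adj Et)\<^sup>*" for z
    using that
  proof (induction rule: rtrancl_induct)
    case (step y z)
    show ?case
    proof (cases "{y, z} = e")
      case True
      then show ?thesis using v by (auto simp: doubleton_eq_iff)
    next
      case False
      then have "(y, z) \<in> adj (Et - {e})" using step.hyps by (auto simp: adj_def)
      then show ?thesis using step.IH by (meson rtrancl.rtrancl_into_rtrancl)
    qed
  qed simp
  have cov: "(u, Inl q) \<in> ?R \<or> (v, Inl q) \<in> ?R" if "q < N" for q
    using that uV by (intro cover D(5)) (auto simp: leaf_vertices_def)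
  have side: "q \<in> edge_side N Et e \<longleftrightarrow> (u, Inl q) \<in> ?R" if "q < N" for q
    using that by (simp add: edge_side_def u_def)
  show ?thesis unfolding side[OF xy(1)] side[OF xy(2)]
    using cov[OF xy(1)] cov[OF xy(2)] adj_rtrancl_sym rtrancl_trans by metis
qed

lemma subcubic_tree_restrict:
  assumes T: "subcubic_tree N I Et" and \<sigma>: "inj_on \<sigma> {0..<n}" "\<sigma> ` {0..<n} \<subseteq> {0..<N}" and n: "2 \<le> n"
  obtains I' Et' where "subcubic_tree n I' Et'"
    "\<And>e'. e' \<in> Et' \<Longrightarrow> \<exists>e\<in>Et. edge_side n Et' e' = {k. k < n \<and> \<sigma> k \<in> edge_side N Et e} \<or>
       edge_side n Et' e' = {k. k < n \<and> \<sigma> k \<in> {0..<N} - edge_side N Et e}"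
proof -
  let ?L = "\<sigma> ` {0..<n}"
  have un: "?L \<union> ({0..<N} - ?L) = {0..<N}" using \<sigma>(2) by auto
  have "card ?L = n" using card_image[OF \<sigma>(1)] by simp
  then obtain I' E1 where E1: "leaf_tree ?L I' E1" "same_splits ?L E1 Et"
    using leaf_tree_restrict[of "{0..<N} - ?L" ?L I Et] T n unfolding un subcubic_tree_iff by auto
  let ?\<tau> = "the_inv_into {0..<n} \<sigma>"
  have \<tau>: "inj_on ?\<tau> ?L" "?\<tau> ` ?L = {0..<n}" "\<And>k. k < n \<Longrightarrow> ?\<tau> (\<sigma> k) = k"
    using inj_on_the_inv_into[OF \<sigma>(1)] the_inv_into_onto[OF \<sigma>(1)] the_inv_into_f_f[OF \<sigma>(1)] by auto
  obtain E2 where E2: "leaf_tree {0..<n} I' E2"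
    "\<And>e2. e2 \<in> E2 \<Longrightarrow> \<exists>e\<in>E1. \<forall>x\<in>?L. \<forall>y\<in>?L.
      (Inl (?\<tau> x), Inl (?\<tau> y)) \<in> (adj (E2 - {e2}))\<^sup>* \<longleftrightarrow> (Inl x, Inl y) \<in> (adj (E1 - {e}))\<^sup>*"
    using leaf_tree_relabel[OF E1(1) \<tau>(1)] unfolding \<tau>(2) by metis
  have T2: "subcubic_tree n I' E2" using E2(1) by (simp add: subcubic_tree_iff)
  show thesis
  proof (rule that[OF T2])
    fix e2 assume e2: "e2 \<in> E2"
    obtain e1 where e1: "e1 \<in> E1" "\<And>x y. x \<in> ?L \<Longrightarrow> y \<in> ?L \<Longrightarrow>
        (Inl (?\<tau> x), Inl (?\<tau> y)) \<in> (adj (E2 - {e2}))\<^sup>* \<longleftrightarrow> (Inl x, Inl y) \<in> (adj (E1 - {e1}))\<^sup>*"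
      using E2(2)[OF e2] by blast
    obtain e where e: "e \<in> Et" "\<And>x y. x \<in> ?L \<Longrightarrow> y \<in> ?L \<Longrightarrow>
        (Inl x, Inl y) \<in> (adj (E1 - {e1}))\<^sup>* \<longleftrightarrow> (Inl x, Inl y) \<in> (adj (Et - {e}))\<^sup>*"
      using bspec[OF E1(2)[unfolded same_splits_def] e1(1)] by blast
    define S where "S = edge_side N Et e"
    define S' where "S' = edge_side n E2 e2"
    have S': "S' \<subseteq> {0..<n}" by (auto simp: S'_def edge_side_def)
    have \<sigma>N: "\<sigma> k < N" if "k < n" for k using \<sigma>(2) that by (auto simp: image_subset_iff)
    have iff: "(k \<in> S' \<longleftrightarrow> l \<in> S') \<longleftrightarrow> (\<sigma> k \<in> S \<longleftrightarrow> \<sigma> l \<in> S)" if kl: "k < n" "l < n" for k l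
    proof -
      have "(k \<in> S' \<longleftrightarrow> l \<in> S') \<longleftrightarrow> (Inl k, Inl l) \<in> (adj (E2 - {e2}))\<^sup>*"
        unfolding S'_def by (rule edge_side_iff[OF T2 e2 kl, symmetric])
      also have "\<dots> \<longleftrightarrow> (Inl (\<sigma> k), Inl (\<sigma> l)) \<in> (adj (E1 - {e1}))\<^sup>*"
        using e1(2)[of "\<sigma> k" "\<sigma> l"] kl by (simp add: \<tau>(3))
      also have "\<dots> \<longleftrightarrow> (Inl (\<sigma> k), Inl (\<sigma> l)) \<in> (adj (Et - {e}))\<^sup>*"
        using e(2)[of "\<sigma> k" "\<sigma> l"] kl by simp
      also have "\<dots> \<longleftrightarrow> (\<sigma> k \<in> S \<longleftrightarrow> \<sigma> l \<in> S)"
        unfolding S_def by (rule edge_side_iff[OF T e(1) \<sigma>N[OF kl(1)] \<sigma>N[OF kl(2)]])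
      finally show ?thesis .
    qed
    have "S' = {k. k < n \<and> \<sigma> k \<in> S} \<or> S' = {k. k < n \<and> \<sigma> k \<in> {0..<N} - S}"
    \<comment> \<open>Equal same-side relations determine the sets up to complement; leaf 0 serves
      as reference to decide which alternative holds.\<close>
    proof (cases "0 \<in> S' \<longleftrightarrow> \<sigma> 0 \<in> S")
      case True
      then have "k \<in> S' \<longleftrightarrow> \<sigma> k \<in> S" if "k < n" for k using iff[OF that, of 0] n by auto
      then show ?thesis using S' by (intro disjI1) auto
    next
      case False
      then have "k \<in> S' \<longleftrightarrow> \<sigma> k \<notin> S" if "k < n" for k using iff[OF that, of 0] n by auto
      then show ?thesis using S' \<sigma>N by (intro disjI2) auto
    qed
    then show "\<exists>e\<in>Et. edge_side n E2 e2 = {k. k < n \<and> \<sigma> k \<in> edge_side N Et e} \<or>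
       edge_side n E2 e2 = {k. k < n \<and> \<sigma> k \<in> {0..<N} - edge_side N Et e}"
      using e(1) unfolding S_def S'_def by blast
  qed
qed

section \<open>Edges and existence of trees\<close>

lemma subcubic_tree_edges:
  assumes "subcubic_tree N I Et" "2 \<le> N"
  shows "finite Et" "Et \<noteq> {}"
proof -
  note D = leaf_treeD[OF assms(1)[unfolded subcubic_tree_iff]]
  show "finite Et" by (rule D(8))
  have "card (Inl ` {0..<N} :: vtx set) \<le> card (leaf_vertices {0..<N} I)"
    using D(7) by (intro card_mono) (auto simp: leaf_vertices_def)
  then have "N \<le> card Et + 1" unfolding D(6) by (simp add: card_image)
  then show "Et \<noteq> {}" using assms(2) by auto
qed

text \<open>An edge is subdivided by a fresh inner vertex, and the new leaf is attached there. The
  old vertices keep their degrees and the new inner vertex gets degree 3.\<close>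

lemma subcubic_tree_extend:
  assumes T: "subcubic_tree N I Et" and N: "2 \<le> N"
  shows "\<exists>I' Et'. subcubic_tree (Suc N) I' Et'"
proof -
  note D = leaf_treeD[OF T[unfolded subcubic_tree_iff]]
  obtain e where e: "e \<in> Et" using subcubic_tree_edges[OF T N] by auto
  obtain u v where uv: "e = {u, v}" "u \<noteq> v" using D(3)[OF e] by (auto simp: card_2_iff)
  obtain k where k: "k \<notin> I" using ex_new_if_finite[OF infinite_UNIV_nat D(2)] by auto
  define V where "V = leaf_vertices {0..<N} I"
  define w :: vtx where "w = Inr k"
  define Q :: vtx where "Q = Inl N"
  define E' where "E' = (Et - {e}) \<union> {{u, w}, {v, w}, {Q, w}}"
  have V': "leaf_vertices {0..<Suc N} (insert k I) = insert Q (insert w V)"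
    by (auto simp: V_def leaf_vertices_def Q_def w_def less_Suc_eq)
  have new: "w \<notin> V" "Q \<notin> V" "Q \<noteq> w" using k by (auto simp: V_def leaf_vertices_def Q_def w_def)
  have EV: "d \<subseteq> V" if "d \<in> Et" for d using D(4)[OF that] by (simp add: V_def)
  have uvV: "u \<in> V" "v \<in> V" using EV[OF e] uv by auto
  have ne: "u \<noteq> w" "v \<noteq> w" "u \<noteq> Q" "v \<noteq> Q" using uvV new by auto
  have notEt: "{x, w} \<notin> Et" for x using EV new by auto
  have new_dist: "{u, w} \<noteq> {v, w}" "{u, w} \<noteq> {Q, w}" "{v, w} \<noteq> {Q, w}"
    using uv ne by (auto simp: doubleton_eq_iff)
  have cE': "card E' = card Et + 2"
  proof -
    have "card E' = card (Et - {e}) + card {{u, w}, {v, w}, {Q, w}}"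
      unfolding E'_def using D(8) notEt by (intro card_Un_disjoint) auto
    moreover have "card Et > 0" using D(8) e by (auto simp: card_gt_0_iff)
    ultimately show ?thesis using new_dist e D(8) by (simp add: card_Diff_singleton)
  qed
  have uw: "(u, w) \<in> adj E'" "(w, u) \<in> adj E'" "(v, w) \<in> adj E'" "(w, v) \<in> adj E'" "(w, Q) \<in> adj E'"
    by (auto simp: adj_def E'_def insert_commute)
  have old: "(x, y) \<in> (adj E')\<^sup>*" if xy: "(x, y) \<in> adj Et" for x y
  proof (cases "{x, y} = e")
    case True
    then show ?thesis unfolding uv doubleton_eq_iff using uw by (meson converse_rtrancl_into_rtrancl r_into_rtrancl)
  next
    case False
    then show ?thesis using xy by (intro r_into_rtrancl) (auto simp: adj_def E'_def)
  qed
  have root: "(u, x) \<in> (adj E')\<^sup>*" if x: "x \<in> insert Q (insert w V)" for x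
  proof -
    have "(u, x) \<in> (adj E')\<^sup>*" if "x \<in> V"
    proof -
      have "(u, x) \<in> (adj Et)\<^sup>*" using D(5) that uvV by (simp add: V_def)
      then show ?thesis by (rule rtrancl_hom[where f = "\<lambda>v. v"]) (rule old)
    qed
    moreover have "(u, w) \<in> (adj E')\<^sup>*" using uw by blast
    moreover have "(u, Q) \<in> (adj E')\<^sup>*" using uw by (meson converse_rtrancl_into_rtrancl r_into_rtrancl)
    ultimately show ?thesis using x by blast
  qed
  have deg: "Defs.degree E' x = Defs.degree Et x" if x: "x \<in> V" for x
  proof -
    have xw: "x \<noteq> w" "x \<noteq> Q" using x new by auto
    have fin: "finite {d \<in> Et. x \<in> d}" using D(8) by simp
    consider "x = u" | "x = v" | "x \<noteq> u" "x \<noteq> v" by blast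
    then show ?thesis
    proof cases
      case 1
      have "{d \<in> E'. x \<in> d} = insert {u, w} ({d \<in> Et. x \<in> d} - {e})"
        using 1 xw uv by (auto simp: E'_def)
      moreover have "card (insert {u, w} ({d \<in> Et. x \<in> d} - {e})) = card {d \<in> Et. x \<in> d}"
        using fin e notEt 1 uv by (intro card_insert_remove) auto
      ultimately show ?thesis by (simp add: degree_def)
    next
      case 2
      have "{d \<in> E'. x \<in> d} = insert {v, w} ({d \<in> Et. x \<in> d} - {e})"
        using 2 xw uv by (auto simp: E'_def)
      moreover have "card (insert {v, w} ({d \<in> Et. x \<in> d} - {e})) = card {d \<in> Et. x \<in> d}"
        using fin e notEt 2 uv by (intro card_insert_remove) auto
      ultimately show ?thesis by (simp add: degree_def)
    next
      case 3
      then have "{d \<in> E'. x \<in> d} = {d \<in> Et. x \<in> d}" using xw uv by (auto simp: E'_def)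
      then show ?thesis by (simp add: degree_def)
    qed
  qed
  have degw: "Defs.degree E' w = 3"
  proof -
    have "{d \<in> E'. w \<in> d} = {{u, w}, {v, w}, {Q, w}}" using EV new by (auto simp: E'_def)
    then show ?thesis using new_dist by (simp add: degree_def)
  qed
  have degQ: "Defs.degree E' Q = 1"
  proof -
    have "{d \<in> E'. Q \<in> d} = {{Q, w}}" using EV new ne by (auto simp: E'_def)
    then show ?thesis by (simp add: degree_def)
  qed
  have "leaf_tree {0..<Suc N} (insert k I) E'"
    unfolding leaf_tree_def V'
  proof (intro conjI ballI)
    show "card d = 2" if "d \<in> E'" for d using that D(3) ne new by (auto simp: E'_def)
    show "d \<subseteq> insert Q (insert w V)" if "d \<in> E'" for d using that EV uvV by (auto simp: E'_def)
    show "(x, y) \<in> (adj E')\<^sup>*" if "x \<in> insert Q (insert w V)" "y \<in> insert Q (insert w V)" for x y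
      using root[OF that(1)] root[OF that(2)] adj_rtrancl_sym rtrancl_trans by metis
    show "card E' + 1 = card (insert Q (insert w V))"
      using cE' D(6,7) new by (simp add: V_def)
    show "Defs.degree E' (Inl q) = 1" if "q \<in> {0..<Suc N}" for q
    proof (cases "q = N")
      case True
      then show ?thesis using degQ by (simp add: Q_def)
    next
      case False
      then show ?thesis using that deg[of "Inl q"] D(9)[of q] by (simp add: V_def leaf_vertices_def)
    qed
    show "Defs.degree E' (Inr l) = 3" if "l \<in> insert k I" for l
    proof (cases "l = k")
      case True
      then show ?thesis using degw by (simp add: w_def)
    next
      case False
      then show ?thesis using that deg[of "Inr l"] D(10)[of l] by (simp add: V_def leaf_vertices_def)
    qed
  qed (use D in auto)
  then show ?thesis unfolding subcubic_tree_iff by blast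
qed

text \<open>Guarantees that the infimum in \<open>ent_width\<close> ranges over a nonempty set, so
  that a bound valid for each tree passes to it.\<close>

lemma subcubic_tree_exists:
  assumes "2 \<le> N"
  shows "\<exists>I Et. subcubic_tree N I Et"
  using assms
proof (induction N rule: dec_induct)
  case base
  let ?E = "{{Inl 0, Inl 1}} :: vtx set set"
  have V: "leaf_vertices {0..<2} {} = {Inl 0, Inl 1}"
    by (auto simp: leaf_vertices_def numeral_2_eq_2 less_Suc_eq)
  have adj: "(Inl 0, Inl 1) \<in> adj ?E" "(Inl 1, Inl 0) \<in> adj ?E" by (auto simp: adj_def insert_commute)
  have "leaf_tree {0..<2} {} ?E"
    unfolding leaf_tree_def V
  proof (intro conjI ballI)
    show "(u, v) \<in> (adj ?E)\<^sup>*" if "u \<in> {Inl 0, Inl 1}" "v \<in> {Inl 0, Inl 1}" for u v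
      using that adj by blast
    show "Defs.degree ?E (Inl q) = 1" if "q \<in> {0..<2}" for q
    proof -
      have "q = 0 \<or> q = 1" using that by auto
      then have "{e \<in> ?E. Inl q \<in> e} = ?E" by auto
      then show ?thesis by (simp only: degree_def card_1_singleton_iff) simp
    qed
  qed auto
  then show ?case unfolding subcubic_tree_iff by blast
next
  case (step N)
  then show ?case using subcubic_tree_extend by blast
qed

section \<open>Monotonicity of the width\<close>

definition tree_width :: "nat \<Rightarrow> (cfg \<Rightarrow> complex) \<Rightarrow> nat set \<times> vtx set set \<Rightarrow> real" where
  "tree_width N \<psi> T = (MAX e\<in>snd T. ent_entropy N (edge_side N (snd T) e) \<psi>)"

lemma ent_width_INF:
  "2 \<le> N \<Longrightarrow> ent_width N \<psi> = (INF T\<in>{(I, Et). subcubic_tree N I Et}. tree_width N \<psi> T)"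
  by (simp add: ent_width_def tree_width_def)

lemma edge_side_subset: "edge_side N Et e \<subseteq> {0..<N}"
  by (auto simp: edge_side_def)

lemma tree_width_ge:
  assumes "subcubic_tree N I Et" "2 \<le> N" "e \<in> Et"
  shows "ent_entropy N (edge_side N Et e) \<psi> \<le> tree_width N \<psi> (I, Et)"
  unfolding tree_width_def using subcubic_tree_edges[OF assms(1,2)] assms(3) by (intro Max_ge) auto

text \<open>Serves twice: as the lower bound that makes the infimum well behaved, and for comparison
  with the conventional width 0 of targets with fewer than two qubits.\<close>

lemma tree_width_nonneg:
  assumes "subcubic_tree N I Et" "2 \<le> N" "vnorm N \<psi> = 1"
  shows "0 \<le> tree_width N \<psi> (I, Et)"
proof -
  obtain e where e: "e \<in> Et" using subcubic_tree_edges[OF assms(1,2)] by auto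
  show ?thesis
    by (rule order_trans[OF ent_entropy_nonneg[OF edge_side_subset assms(3)] tree_width_ge[OF assms(1,2) e]])
qed

lemma ent_width_le_tree_width:
  assumes \<psi>: "vnorm N \<psi> = 1" and \<phi>: "vnorm n \<phi> = 1" and geq: "locc_geq N \<psi> n \<phi>"
    and n: "2 \<le> n" and T: "subcubic_tree N I Et"
  shows "ent_width n \<phi> \<le> tree_width N \<psi> (I, Et)"
proof -
  obtain \<sigma> where \<sigma>: "inj_on \<sigma> {0..<n}" "\<sigma> ` {0..<n} \<subseteq> {0..<N}" "locc_conv N \<psi> (embed_state n \<sigma> \<phi>)"
    and N: "2 \<le> N" using geq n by (auto simp: locc_geq_def)
  obtain I' Et' where T': "subcubic_tree n I' Et'"
    "\<And>e'. e' \<in> Et' \<Longrightarrow> \<exists>e\<in>Et. edge_side n Et' e' = {k. k < n \<and> \<sigma> k \<in> edge_side N Et e} \<or>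
       edge_side n Et' e' = {k. k < n \<and> \<sigma> k \<in> {0..<N} - edge_side N Et e}"
  proof (rule subcubic_tree_restrict[OF T \<sigma>(1,2) n], goal_cases)
    case (1 I' Et')
    show ?case by (rule that[of I' Et']; fact 1)
  qed
  have "ent_width n \<phi> \<le> tree_width n \<phi> (I', Et')"
    unfolding ent_width_INF[OF n]
  proof (rule cINF_lower)
    show "bdd_below (tree_width n \<phi> ` {(I, Et). subcubic_tree n I Et})"
      using tree_width_nonneg[OF _ n \<phi>] by (intro bdd_belowI[of _ 0]) auto
  qed (use T' in simp)
  also have "\<dots> \<le> tree_width N \<psi> (I, Et)"
    unfolding tree_width_def[of n]
  proof (rule Max.boundedI)
    fix x assume "x \<in> (\<lambda>e. ent_entropy n (edge_side n (snd (I', Et')) e) \<phi>) ` snd (I', Et')"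
    then obtain e' where e': "e' \<in> Et'" "x = ent_entropy n (edge_side n Et' e') \<phi>" by auto
    obtain e where e: "e \<in> Et" "edge_side n Et' e' = {k. k < n \<and> \<sigma> k \<in> edge_side N Et e} \<or>
       edge_side n Et' e' = {k. k < n \<and> \<sigma> k \<in> {0..<N} - edge_side N Et e}"
      using T'(2)[OF e'(1)] by blast
    let ?A = "edge_side N Et e"
    \<comment> \<open>Stated for arbitrary \<open>A\<close>, because it is applied both to the side
      of \<open>e\<close> and to its complement.\<close>
    have mono: "ent_entropy n {k. k < n \<and> \<sigma> k \<in> A} \<phi> \<le> ent_entropy N A \<psi>" if "A \<subseteq> {0..<N}" for A
      unfolding ent_entropy_embed_state[OF \<sigma>(1,2) that, symmetric]
      by (rule ent_entropy_locc_mono[OF \<sigma>(3) \<psi> that])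
    have "x \<le> ent_entropy N ?A \<psi>"
      using e(2) mono[OF edge_side_subset] mono[OF Diff_subset, of ?A]
      unfolding e'(2) ent_entropy_complement[OF edge_side_subset] by auto
    also have "\<dots> \<le> tree_width N \<psi> (I, Et)" by (rule tree_width_ge[OF T N e(1)])
    finally show "x \<le> tree_width N \<psi> (I, Et)" .
  qed (use subcubic_tree_edges[OF T'(1) n] in auto)
  finally show ?thesis .
qed

theorem theorem3:
  shows "type2_monotone ent_width"
  unfolding type2_monotone_def
proof (intro allI impI)
  fix N n \<psi> \<phi>
  assume "pure_state N \<psi>" "pure_state n \<phi>" and geq: "locc_geq N \<psi> n \<phi>"
  then have \<psi>: "vnorm N \<psi> = 1" and \<phi>: "vnorm n \<phi> = 1" by (auto simp: pure_state_def)
  have nN: "n \<le> N" using geq by (simp add: locc_geq_def)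
  show "ent_width n \<phi> \<le> ent_width N \<psi>"
  proof (cases "2 \<le> N")
    case False
    \<comment> \<open>Both systems have fewer than two qubits, so both widths are 0.\<close>
    then show ?thesis using nN by (simp add: ent_width_def)
  next
    case True
    have "ent_width n \<phi> \<le> tree_width N \<psi> (I, Et)" if T: "subcubic_tree N I Et" for I Et
    proof (cases "2 \<le> n")
      case True
      then show ?thesis using ent_width_le_tree_width[OF \<psi> \<phi> geq] T by blast
    next
      case False
      \<comment> \<open>The target has no tree and conventional width 0, while the source tree has
        nonnegative width.\<close>
      then show ?thesis using tree_width_nonneg[OF T True \<psi>] by (simp add: ent_width_def)
    qed
    then show ?thesis unfolding ent_width_INF[OF True]
      using subcubic_tree_exists[OF True] by (intro cINF_greatest) auto
  qed
qed

end
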